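(* Let $\mathbf{Q},\mathbf{Z}\in\mathbb{R}^6$ be fixed. For $\mathbf{X}=(\mathbf{x},\mathbf{y})\in\mathbb{R}^3\times\mathbb{R}^3$, write $\mathbf{Z}_i:=\mathbf{ad}_{\mathbf{X}}^i\mathbf{Z}$ and $\overline{\mathbf{Q}}_i:=(\mathbf{ad}_{\mathbf{X}}^i)^T\mathbf{Q}$. The Hessian of $h(\mathbf{X})=\mathbf{Q}^T\mathbf{dexp}_{\mathbf{X}}\mathbf{Z}$ is $\mathbf{H}=\mathbf{H}_1+\mathbf{H}_2+\mathbf{H}_3$ with $$\mathbf{H}_1=\sum_{i=1}^4\mathbf{H}_{1i},\quad \mathbf{H}_2=\sum_{i=2}^4(\mathbf{H}_{2i}+\mathbf{H}_{2i}^T),\quad \mathbf{H}_3=\sum_{i=1}^4(\mathbf{H}_{3i}+\mathbf{H}_{3i}^T),$$ where $$\mathbf{H}_{1i}=\begin{bmatrix}\left(\bar a_i\mathbf{I}+\breve a_i\mathbf{x}\mathbf{x}^T\right)\mathbf{Q}^T\mathbf{Z}_i&\mathbf{0}\\ \mathbf{0}&\mathbf{0}\end{bmatrix},$$ $$\mathbf{H}_{22}=a_2\,\overline{\mathbf{ad}}_{\mathbf{Q}}\mathbf{ad}_{\mathbf{Z}},$$ $$\mathbf{H}_{23}=a_3\left(\overline{\mathbf{ad}}_{\overline{\mathbf{Q}}_1}\mathbf{ad}_{\mathbf{Z}}+\overline{\mathbf{ad}}_{\mathbf{Q}}\mathbf{ad}_{\mathbf{X}}\mathbf{ad}_{\mathbf{Z}}+\overline{\mathbf{ad}}_{\mathbf{Q}}\mathbf{ad}_{\mathbf{Z}_1}\right),$$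 $$\mathbf{H}_{24}=a_4\left(\overline{\mathbf{ad}}_{\overline{\mathbf{Q}}_2}\mathbf{ad}_{\mathbf{Z}}+\overline{\mathbf{ad}}_{\overline{\mathbf{Q}}_1}\left(\mathbf{ad}_{\mathbf{Z}_1}+\mathbf{ad}_{\mathbf{X}}\mathbf{ad}_{\mathbf{Z}}\right)+\overline{\mathbf{ad}}_{\mathbf{Q}}\left(\mathbf{ad}_{\mathbf{X}}^2\mathbf{ad}_{\mathbf{Z}}+\mathbf{ad}_{\mathbf{X}}\mathbf{ad}_{\mathbf{Z}_1}+\mathbf{ad}_{\mathbf{Z}_2}\right)\right),$$ $$\mathbf{H}_{31}=-\bar a_1\begin{bmatrix}\mathbf{x}\\ \mathbf{0}\end{bmatrix}\mathbf{Q}^T\mathbf{ad}_{\mathbf{Z}},\qquad \mathbf{H}_{32}=\bar a_2\begin{bmatrix}\mathbf{x}\\ \mathbf{0}\end{bmatrix}\mathbf{Q}^T\left(\mathbf{ad}_{\mathbf{Z}}\mathbf{ad}_{\mathbf{X}}-2\mathbf{ad}_{\mathbf{X}}\mathbf{ad}_{\mathbf{Z}}\right),$$ $$\mathbf{H}_{33}=-\bar a_3\begin{bmatrix}\mathbf{x}\\ \mathbf{0}\end{bmatrix}\mathbf{Q}^T\left(\mathbf{ad}_{\mathbf{X}}^2\mathbf{ad}_{\mathbf{Z}}+\mathbf{ad}_{\mathbf{X}}\mathbf{ad}_{\mathbf{Z}_1}+\mathbf{ad}_{\mathbf{Z}_2}\right),$$ $$\mathbf{H}_{34}=-\bar a_4\begin{bmatrix}\mathbf{x}\\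 \mathbf{0}\end{bmatrix}\mathbf{Q}^T\left(\mathbf{ad}_{\mathbf{X}}^3\mathbf{ad}_{\mathbf{Z}}+\mathbf{ad}_{\mathbf{X}}\mathbf{ad}_{\mathbf{Z}_2}+\mathbf{ad}_{\mathbf{X}}^2\mathbf{ad}_{\mathbf{Z}_1}+\mathbf{ad}_{\mathbf{Z}_3}\right).$$ For $\mathbf{X}$ with $\beta\neq0$, the Hessian of $h^{\mathrm{inv}}(\mathbf{X})=\mathbf{Q}^T\mathbf{dexp}_{\mathbf{X}}^{-1}\mathbf{Z}$ is $\mathbf{H}^{\mathrm{inv}}=\mathbf{H}_1^{\mathrm{inv}}+\mathbf{H}_2^{\mathrm{inv}}+\mathbf{H}_3^{\mathrm{inv}}$ with $$\mathbf{H}_1^{\mathrm{inv}}=\sum_{i=2,4}\mathbf{H}_{1i}^{\mathrm{inv}},\quad \mathbf{H}_2^{\mathrm{inv}}=\sum_{i=2,4}\left(\mathbf{H}_{2i}^{\mathrm{inv}}+(\mathbf{H}_{2i}^{\mathrm{inv}})^T\right),\quad \mathbf{H}_3^{\mathrm{inv}}=\sum_{i=2,4}\left(\mathbf{H}_{3i}^{\mathrm{inv}}+(\mathbf{H}_{3i}^{\mathrm{inv}})^T\right),$$ where $\mathbf{H}_{1i}^{\mathrm{inv}},\mathbf{H}_{2i}^{\mathrm{inv}},\mathbf{H}_{3i}^{\mathrm{inv}}$ are obtained from $\mathbf{H}_{1i},\mathbf{H}_{2i},\mathbf{H}_{3i}$ above by replacing $a_i,\bar a_i,\breve a_i$ with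 $b_i,\bar b_i,\breve b_i$, respectively.
   Context: For $\mathbf{x}\in\mathbb{R}^3$, $\tilde{\mathbf{x}}$ is the skew-symmetric matrix with $\tilde{\mathbf{x}}\mathbf{w}=\mathbf{x}\times\mathbf{w}$. For $\mathbf{X}=(\mathbf{x},\mathbf{y})\in\mathbb{R}^3\times\mathbb{R}^3\cong se(3)$, $\mathbf{ad}_{\mathbf{X}}=\begin{bmatrix}\tilde{\mathbf{x}}&\mathbf{0}\\ \tilde{\mathbf{y}}&\tilde{\mathbf{x}}\end{bmatrix}$; for $\mathbf{U}=(\mathbf{u},\mathbf{v})$, $\overline{\mathbf{ad}}_{\mathbf{U}}:=\begin{bmatrix}\tilde{\mathbf{u}}&\tilde{\mathbf{v}}\\ \tilde{\mathbf{v}}&\mathbf{0}\end{bmatrix}$, so that $\mathbf{ad}_{\mathbf{X}}^T\mathbf{U}=\overline{\mathbf{ad}}_{\mathbf{U}}\mathbf{X}$. The matrix of the right-trivialized differential of $\exp$ on $SE(3)$ is $\mathbf{dexp}_{\mathbf{X}}=\sum_{i\ge0}\frac1{(i+1)!}\mathbf{ad}_{\mathbf{X}}^i=\mathbf{I}+\sum_{i=1}^4a_i\mathbf{ad}_{\mathbf{X}}^i$, and its inverse matrix is $\mathbf{dexp}_{\mathbf{X}}^{-1}=\mathbf{I}+b_1\mathbf{ad}_{\mathbf{X}}+b_2\mathbf{ad}_{\mathbf{X}}^2+b_4\mathbf{ad}_{\mathbf{X}}^4$. The Hessian of a scalar function $h$ is $\left[\frac{\partial^2h}{\partial X_i\partial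 X_j}\right]\in\mathbb{R}^{6\times6}$. Put $\varphi:=\|\mathbf{x}\|$, $\mathrm{sinc}\,t=\sin t/t$, $\alpha:=\mathrm{sinc}\,\varphi$, $\beta:=\mathrm{sinc}^2\frac\varphi2$, $\gamma:=\alpha/\beta$, $\delta:=\frac{1-\alpha}{\varphi^2}$. Then $a_1=\beta-\frac\alpha2$, $a_2=\frac12(5\delta-\frac\beta2)$, $a_3=\frac1{2\varphi^2}(\beta-\alpha)$, $a_4=\frac1{2\varphi^2}(3\delta-\frac\beta2)$; $b_1=-\frac12$, $b_2=\frac1{\varphi^2}(2-\frac{1+3\alpha}{2\beta})$, $b_4=\frac1{\varphi^4}(1-\frac{1+\alpha}{2\beta})$; $\bar a_1=\frac14\beta+\frac1{\varphi^2}(\frac52\alpha-2\beta-\frac12)$, $\bar a_2=\frac1{\varphi^2}(\frac74\beta-\frac12\alpha)+\frac{15}{2\varphi^4}(\alpha-1)$, $\bar a_3=\bar a_1/\varphi^2$, $\bar a_4=\bar a_2/\varphi^2$; $\bar b_2=\frac3{4\varphi^2}+\frac1{\varphi^4}\left(\gamma(\frac32+\frac1\beta+3\gamma)-\frac3{2\beta}-4\right)$, $\bar b_4=\frac1{4\varphi^4}+\frac1{\varphi^6}\left(\frac1{2\beta}+\frac32\gamma+\frac\gamma\beta+\gamma^2-4\right)$; $\breve a_1=\frac1{\varphi^2}(\frac\alpha2-\frac74\beta)+\frac1{\varphi^4}(\frac72-\frac{23}2\alpha+8\beta)$, $\breve a_2=\frac{\beta}{4\varphi^2}+\frac1{\varphi^4}(5\alpha-\frac{43}4\beta-\frac12)+\frac{75}{2\varphi^6}(1-\alpha)$,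 $\breve a_3=\frac1{\varphi^4}(\frac12\alpha-\frac94\beta)+\frac1{\varphi^6}(\frac92-\frac{33}2\alpha+12\beta)$, $\breve a_4=\frac{\beta}{4\varphi^4}+\frac1{\varphi^6}(6\alpha-\frac12-\frac{57}4\beta)+\frac{105}{2\varphi^8}(1-\alpha)$; $\breve b_2=\frac1{\varphi^6}\left(16+\frac1{\beta^2}+(\frac8\beta-\frac92)\gamma-(9+\frac4\beta)\gamma^2-12\gamma^3+\frac9{2\beta}\right)-\frac1{\varphi^4}\left(\frac94+3\gamma+\frac1{2\beta}\right)$, $\breve b_4=\frac1{\varphi^8}\left(24-\frac2\beta-(\frac{15}2+\frac4\beta)\gamma-(\frac{11}2+\frac3\beta)\gamma^2-2\gamma^3\right)-\frac1{\varphi^6}\left(\frac{11}8+\frac1{4\beta}+\frac12\gamma\right)$. These are analytic functions; at $\varphi=0$ they are understood through their (finite) limits. *)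

theory Defs
  imports "HOL-Analysis.Analysis" "HOL-Probability.Sinc_Integral"
begin

text \<open>
  The index type \<open>3 + 3\<close> is a disjoint sum: \<open>Inl\<close> indexes the first three coordinates
  and \<open>Inr\<close> the last three.
\<close>

type_synonym vec3 = "real^3"
type_synonym vec6 = "real^(3 + 3)"
type_synonym mat3 = "real^3^3"
type_synonym mat6 = "real^(3 + 3)^(3 + 3)"

definition vec_pair :: "vec3 \<Rightarrow> vec3 \<Rightarrow> vec6" where
  "vec_pair x y = (\<chi> i. case i of Inl k \<Rightarrow> x $ k | Inr k \<Rightarrow> y $ k)"

definition vec_fst :: "vec6 \<Rightarrow> vec3" where
  "vec_fst X = (\<chi> k. X $ Inl k)"

definition vec_snd :: "vec6 \<Rightarrow> vec3" where
  "vec_snd X = (\<chi> k. X $ Inr k)"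

definition block :: "mat3 \<Rightarrow> mat3 \<Rightarrow> mat3 \<Rightarrow> mat3 \<Rightarrow> mat6" where
  "block A B C D = (\<chi> i j.
     case i of
       Inl k \<Rightarrow> (case j of Inl l \<Rightarrow> A $ k $ l | Inr l \<Rightarrow> B $ k $ l)
     | Inr k \<Rightarrow> (case j of Inl l \<Rightarrow> C $ k $ l | Inr l \<Rightarrow> D $ k $ l))"

definition outer :: "real^'m \<Rightarrow> real^'n \<Rightarrow> real^'n^'m" where
  "outer u v = (columnvector u :: real^1^'m) ** (rowvector v :: real^'n^1)"

text \<open>Powers for the matrix product; note that \<open>^\<close> on type \<open>vec\<close> acts componentwise.\<close>

definition matpow :: "real^'n^'n \<Rightarrow> nat \<Rightarrow> real^'n^'n" where
  "matpow A n = (((**) A) ^^ n) (mat 1)"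

definition skew :: "vec3 \<Rightarrow> mat3" where
  "skew x = matrix (cross3 x)"

definition ad :: "vec6 \<Rightarrow> mat6" where
  "ad X = block (skew (vec_fst X)) 0 (skew (vec_snd X)) (skew (vec_fst X))"

definition ad_bar :: "vec6 \<Rightarrow> mat6" where
  "ad_bar U = block (skew (vec_fst U)) (skew (vec_snd U)) (skew (vec_snd U)) 0"

definition dexp :: "vec6 \<Rightarrow> mat6" where
  "dexp X = (\<Sum>i. (1 / fact (i + 1)) *\<^sub>R matpow (ad X) i)"

definition dexp_inv :: "vec6 \<Rightarrow> mat6" where
  "dexp_inv X = matrix_inv (dexp X)"

definition has_partial :: "(real^'n \<Rightarrow> real) \<Rightarrow> real \<Rightarrow> 'n \<Rightarrow> real^'n \<Rightarrow> bool" where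
  "has_partial f D i X \<longleftrightarrow> ((\<lambda>t. f (X + t *\<^sub>R axis i 1)) has_real_derivative D) (at 0)"

text \<open>
  All first partial derivatives exist near \<open>X\<close> (collected in \<open>g\<close>), and all
  second partial derivatives exist at \<open>X\<close> and are the entries of \<open>H\<close>.
\<close>

definition has_hessian :: "(real^'n \<Rightarrow> real) \<Rightarrow> real^'n^'n \<Rightarrow> real^'n \<Rightarrow> bool" where
  "has_hessian f H X \<longleftrightarrow>
     (\<exists>g :: real^'n \<Rightarrow> real^'n.
        (\<forall>\<^sub>F Y in nhds X. \<forall>j. has_partial f (g Y $ j) j Y) \<and>
        (\<forall>i j. has_partial (\<lambda>Y. g Y $ j) (H $ i $ j) i X))"

text \<open>
  The coefficients are functions of \<open>\<phi> = norm x\<close> with removable singularities at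
  \<open>\<phi> = 0\<close>, where the value is the limit. They are even in \<open>\<phi>\<close>, so the two-sided
  limit agrees with the one from the right.
\<close>

definition extend0 :: "(real \<Rightarrow> real) \<Rightarrow> real \<Rightarrow> real" where
  "extend0 f t = (if t = 0 then Lim (at 0) f else f t)"

definition alpha :: "real \<Rightarrow> real" where
  "alpha t = sinc t"

definition beta :: "real \<Rightarrow> real" where
  "beta t = (sinc (t / 2))\<^sup>2"

definition gam :: "real \<Rightarrow> real" where
  "gam t = alpha t / beta t"

definition delta :: "real \<Rightarrow> real" where
  "delta = extend0 (\<lambda>t. (1 - alpha t) / t\<^sup>2)"

definition coeff_a :: "nat \<Rightarrow> real \<Rightarrow> real" where
  "coeff_a i = extend0 (\<lambda>t.
     let \<alpha> = alpha t; \<beta> = beta t; \<delta> = delta t in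
     if i = 1 then \<beta> - \<alpha> / 2
     else if i = 2 then 1 / 2 * (5 * \<delta> - \<beta> / 2)
     else if i = 3 then 1 / (2 * t^2) * (\<beta> - \<alpha>)
     else if i = 4 then 1 / (2 * t^2) * (3 * \<delta> - \<beta> / 2)
     else 0)"

definition coeff_a_bar :: "nat \<Rightarrow> real \<Rightarrow> real" where
  "coeff_a_bar i = extend0 (\<lambda>t.
     let \<alpha> = alpha t; \<beta> = beta t;
         a1 = 1 / 4 * \<beta> + 1 / t^2 * (5 / 2 * \<alpha> - 2 * \<beta> - 1 / 2);
         a2 = 1 / t^2 * (7 / 4 * \<beta> - 1 / 2 * \<alpha>) + 15 / (2 * t^4) * (\<alpha> - 1) in
     if i = 1 then a1
     else if i = 2 then a2
     else if i = 3 then a1 / t^2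
     else if i = 4 then a2 / t^2
     else 0)"

definition coeff_a_breve :: "nat \<Rightarrow> real \<Rightarrow> real" where
  "coeff_a_breve i = extend0 (\<lambda>t.
     let \<alpha> = alpha t; \<beta> = beta t in
     if i = 1 then
       1 / t^2 * (\<alpha> / 2 - 7 / 4 * \<beta>) + 1 / t^4 * (7 / 2 - 23 / 2 * \<alpha> + 8 * \<beta>)
     else if i = 2 then
       \<beta> / (4 * t^2) + 1 / t^4 * (5 * \<alpha> - 43 / 4 * \<beta> - 1 / 2) + 75 / (2 * t^6) * (1 - \<alpha>)
     else if i = 3 then
       1 / t^4 * (1 / 2 * \<alpha> - 9 / 4 * \<beta>) + 1 / t^6 * (9 / 2 - 33 / 2 * \<alpha> + 12 * \<beta>)
     else if i = 4 then
       \<beta> / (4 * t^4) + 1 / t^6 * (6 * \<alpha> - 1 / 2 - 57 / 4 * \<beta>) + 105 / (2 * t^8) * (1 - \<alpha>)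
     else 0)"

definition coeff_b :: "nat \<Rightarrow> real \<Rightarrow> real" where
  "coeff_b i = extend0 (\<lambda>t.
     let \<alpha> = alpha t; \<beta> = beta t in
     if i = 1 then - (1 / 2)
     else if i = 2 then 1 / t^2 * (2 - (1 + 3 * \<alpha>) / (2 * \<beta>))
     else if i = 4 then 1 / t^4 * (1 - (1 + \<alpha>) / (2 * \<beta>))
     else 0)"

definition coeff_b_bar :: "nat \<Rightarrow> real \<Rightarrow> real" where
  "coeff_b_bar i = extend0 (\<lambda>t.
     let \<beta> = beta t; \<gamma> = gam t in
     if i = 2 then
       3 / (4 * t^2) + 1 / t^4 * (\<gamma> * (3 / 2 + 1 / \<beta> + 3 * \<gamma>) - 3 / (2 * \<beta>) - 4)
     else if i = 4 then
       1 / (4 * t^4) + 1 / t^6 * (1 / (2 * \<beta>) + 3 / 2 * \<gamma> + \<gamma> / \<beta> + \<gamma>^2 - 4)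
     else 0)"

definition coeff_b_breve :: "nat \<Rightarrow> real \<Rightarrow> real" where
  "coeff_b_breve i = extend0 (\<lambda>t.
     let \<beta> = beta t; \<gamma> = gam t in
     if i = 2 then
       1 / t^6 * (16 + 1 / \<beta>^2 + (8 / \<beta> - 9 / 2) * \<gamma> - (9 + 4 / \<beta>) * \<gamma>^2
                  - 12 * \<gamma>^3 + 9 / (2 * \<beta>))
       - 1 / t^4 * (9 / 4 + 3 * \<gamma> + 1 / (2 * \<beta>))
     else if i = 4 then
       1 / t^8 * (24 - 2 / \<beta> - (15 / 2 + 4 / \<beta>) * \<gamma> - (11 / 2 + 3 / \<beta>) * \<gamma>^2 - 2 * \<gamma>^3)
       - 1 / t^6 * (11 / 8 + 1 / (4 * \<beta>) + 1 / 2 * \<gamma>)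
     else 0)"

text \<open>
  The coefficients are parameters, so that the same terms serve \<open>dexp\<close> and its inverse.
\<close>

definition Z_it :: "vec6 \<Rightarrow> vec6 \<Rightarrow> nat \<Rightarrow> vec6" where
  "Z_it X Z i = matpow (ad X) i *v Z"

definition Q_it :: "vec6 \<Rightarrow> vec6 \<Rightarrow> nat \<Rightarrow> vec6" where
  "Q_it X Q i = transpose (matpow (ad X) i) *v Q"

definition H1_term ::
  "(nat \<Rightarrow> real \<Rightarrow> real) \<Rightarrow> (nat \<Rightarrow> real \<Rightarrow> real) \<Rightarrow> vec6 \<Rightarrow> vec6 \<Rightarrow> vec6 \<Rightarrow> nat \<Rightarrow> mat6" where
  "H1_term c_bar c_breve Q Z X i =
     (let x = vec_fst X; \<phi> = norm x in
      block ((Q \<bullet> Z_it X Z i) *\<^sub>R (c_bar i \<phi> *\<^sub>R mat 1 + c_breve i \<phi> *\<^sub>R outer x x)) 0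
            0 0)"

definition H2_term :: "(nat \<Rightarrow> real \<Rightarrow> real) \<Rightarrow> vec6 \<Rightarrow> vec6 \<Rightarrow> vec6 \<Rightarrow> nat \<Rightarrow> mat6" where
  "H2_term c Q Z X i =
     (let \<phi> = norm (vec_fst X);
          Z1 = Z_it X Z 1; Z2 = Z_it X Z 2; Q1 = Q_it X Q 1; Q2 = Q_it X Q 2 in
      c i \<phi> *\<^sub>R
       (if i = 2 then ad_bar Q ** ad Z
        else if i = 3 then
          ad_bar Q1 ** ad Z + ad_bar Q ** ad X ** ad Z + ad_bar Q ** ad Z1
        else if i = 4 then
          ad_bar Q2 ** ad Z + ad_bar Q1 ** (ad Z1 + ad X ** ad Z)
          + ad_bar Q ** (matpow (ad X) 2 ** ad Z + ad X ** ad Z1 + ad Z2)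
        else 0))"

definition H3_term :: "(nat \<Rightarrow> real \<Rightarrow> real) \<Rightarrow> vec6 \<Rightarrow> vec6 \<Rightarrow> vec6 \<Rightarrow> nat \<Rightarrow> mat6" where
  "H3_term c_bar Q Z X i =
     (let x = vec_fst X; \<phi> = norm x;
          Z1 = Z_it X Z 1; Z2 = Z_it X Z 2; Z3 = Z_it X Z 3;
          P = outer (vec_pair x 0) Q in
      if i = 1 then - c_bar 1 \<phi> *\<^sub>R (P ** ad Z)
      else if i = 2 then
        c_bar 2 \<phi> *\<^sub>R (P ** (ad Z ** ad X - 2 *\<^sub>R (ad X ** ad Z)))
      else if i = 3 then
        - c_bar 3 \<phi> *\<^sub>R (P ** (matpow (ad X) 2 ** ad Z + ad X ** ad Z1 + ad Z2))
      else if i = 4 then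
        - c_bar 4 \<phi> *\<^sub>R
          (P ** (matpow (ad X) 3 ** ad Z + ad X ** ad Z2 + matpow (ad X) 2 ** ad Z1 + ad Z3))
      else 0)"

definition H1 :: "vec6 \<Rightarrow> vec6 \<Rightarrow> vec6 \<Rightarrow> mat6" where
  "H1 Q Z X = (\<Sum>i=1..4. H1_term coeff_a_bar coeff_a_breve Q Z X i)"

definition H2 :: "vec6 \<Rightarrow> vec6 \<Rightarrow> vec6 \<Rightarrow> mat6" where
  "H2 Q Z X = (\<Sum>i=2..4. H2_term coeff_a Q Z X i + transpose (H2_term coeff_a Q Z X i))"

definition H3 :: "vec6 \<Rightarrow> vec6 \<Rightarrow> vec6 \<Rightarrow> mat6" where
  "H3 Q Z X = (\<Sum>i=1..4. H3_term coeff_a_bar Q Z X i + transpose (H3_term coeff_a_bar Q Z X i))"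

definition H1_inv :: "vec6 \<Rightarrow> vec6 \<Rightarrow> vec6 \<Rightarrow> mat6" where
  "H1_inv Q Z X = (\<Sum>i\<in>{2, 4}. H1_term coeff_b_bar coeff_b_breve Q Z X i)"

definition H2_inv :: "vec6 \<Rightarrow> vec6 \<Rightarrow> vec6 \<Rightarrow> mat6" where
  "H2_inv Q Z X = (\<Sum>i\<in>{2, 4}. H2_term coeff_b Q Z X i + transpose (H2_term coeff_b Q Z X i))"

definition H3_inv :: "vec6 \<Rightarrow> vec6 \<Rightarrow> vec6 \<Rightarrow> mat6" where
  "H3_inv Q Z X = (\<Sum>i\<in>{2, 4}. H3_term coeff_b_bar Q Z X i + transpose (H3_term coeff_b_bar Q Z X i))"

end

theory Submission
  imports Defs
begin

unbundle cross3_syntax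

text \<open>
  Why the formulas hold. On \<open>se(3)\<close> the matrix \<open>A = ad X\<close> satisfies \<open>A (A\<^sup>2 + s)\<^sup>2 = 0\<close>
  with \<open>s = \<parallel>x\<parallel>\<^sup>2\<close> (\<open>ad_cayley_hamilton\<close>). Split a power series in \<open>A\<close> as
  \<open>1 + A p(-A\<^sup>2) + A\<^sup>2 q(-A\<^sup>2)\<close>. Since \<open>-A\<^sup>2 = s - (A\<^sup>2 + s)\<close> and \<open>A (A\<^sup>2 + s)\<^sup>2 = 0\<close>, each of
  \<open>p\<close> and \<open>q\<close> may be replaced by its first order Taylor polynomial at \<open>s\<close>, which gives
  \<open>1 + c\<^sub>1 A + c\<^sub>2 A\<^sup>2 + c\<^sub>3 A\<^sup>3 + c\<^sub>4 A\<^sup>4\<close> with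
  \<open>c\<^sub>1 = p - s p'\<close>, \<open>c\<^sub>3 = - p'\<close>, \<open>c\<^sub>2 = q - s q'\<close>, \<open>c\<^sub>4 = - q'\<close>, all taken at \<open>s\<close>.
  For \<open>dexp\<close> the functions are \<open>p = \<beta> / 2\<close> and \<open>q = \<delta>\<close>; for the inverse they are
  \<open>p = - 1 / 2\<close> and \<open>q = (1 - \<gamma>) / s\<close>.

  All of these are smooth in \<open>s\<close>, also at \<open>s = 0\<close>, because they are built from the entire
  functions \<open>trig_tail j s = \<Sum>k. (- s) ^ k / (2 k + j)!\<close>, whose derivatives are
  combinations of functions of the same family. The barred coefficients are twice the
  \<open>s\<close>-derivatives of the plain ones and the breve coefficients twice the derivatives of the
  barred ones; comparing this with the closed forms in \<open>\<alpha>, \<beta>, \<gamma>\<close> is a computation away from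
  \<open>\<phi> = 0\<close> and continuity at \<open>\<phi> = 0\<close>.

  That the second polynomial is the inverse of the first comes down to two scalar identities
  between \<open>p\<close> and \<open>q\<close> of both (\<open>inverse_even_identity\<close>, \<open>inverse_odd_identity\<close>) together with
  their derivatives, again because replacing \<open>s\<close> by \<open>-A\<^sup>2\<close> is a first order Taylor expansion.

  The Hessian itself (\<open>has_hessian_ad_poly\<close>) is the product rule applied to
  \<open>c\<^sub>i(s) (Q \<bullet> A\<^sup>i Z)\<close>. A direction \<open>V\<close> changes \<open>s\<close> at the rate \<open>2 x \<bullet> v\<close>, and replaces one factor
  \<open>ad X\<close> by \<open>ad V\<close> in each term of the derivative of \<open>A\<^sup>i Z\<close>. Two derivatives of \<open>c\<^sub>i\<close> give \<open>H1\<close>, one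
  gives \<open>H3\<close>, none gives \<open>H2\<close>; the matrices of the statement arise by moving \<open>V\<close> to the outside
  with antisymmetry of the bracket, the Jacobi identity and the duality between \<open>ad\<close> and \<open>ad_bar\<close>.
\<close>

section \<open>Tails of the trigonometric series\<close>

text \<open>
  For \<open>j = 0, 1\<close> and \<open>s = t\<^sup>2\<close> this is \<open>cos t\<close> and \<open>sinc t\<close>; each further \<open>j\<close> divides out leading
  terms of these series: \<open>trig_tail 2 (t\<^sup>2) = \<beta> / 2\<close> and \<open>trig_tail 3 (t\<^sup>2) = \<delta>\<close>. The variable is
  \<open>s = t\<^sup>2\<close>, and not \<open>t\<close>, because \<open>norm x\<close> is not differentiable at \<open>0\<close> while \<open>x \<bullet> x\<close> is.
\<close>

definition trig_tail :: "nat \<Rightarrow> real \<Rightarrow> real" where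
  "trig_tail j s = (\<Sum>k. (- 1) ^ k / fact (2 * k + j) * s ^ k)"

lemma summable_trig_tail: "summable (\<lambda>k. (- 1) ^ k / fact (2 * k + j) * (s::real) ^ k)"
proof (rule summable_comparison_test')
  show "summable (\<lambda>k. \<bar>s\<bar> ^ k / fact k)"
    using summable_exp[of "\<bar>s\<bar>"] by (simp add: divide_inverse mult.commute)
  show "norm ((- 1) ^ k / fact (2 * k + j) * s ^ k) \<le> \<bar>s\<bar> ^ k / fact k" if "k \<ge> 0" for k
    by (auto simp: abs_mult power_abs intro!: divide_left_mono fact_mono)
qed

lemma trig_tail_sums: "(\<lambda>k. (- s) ^ k / fact (2 * k + j)) sums trig_tail j s"
  using summable_sums[OF summable_trig_tail[of j s]]
  by (simp add: trig_tail_def power_minus[of s])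

lemma trig_tail_rec: "trig_tail j s = 1 / fact j - s * trig_tail (j + 2) s"
proof -
  have "(\<lambda>k. (- s) ^ Suc k / fact (2 * Suc k + j)) sums (- s * trig_tail (j + 2) s)"
    using sums_mult[OF trig_tail_sums[of s "j + 2"], of "- s"] by (simp add: add.commute add.left_commute)
  then have "(\<lambda>k. (- s) ^ k / fact (2 * k + j)) sums (- s * trig_tail (j + 2) s + 1 / fact j)"
    using sums_Suc_iff[of "\<lambda>k. (- s) ^ k / fact (2 * k + j)"] by simp
  then show ?thesis
    using sums_unique2[OF trig_tail_sums] by fastforce
qed

text \<open>
  The \<open>n\<close>-th derivative in \<open>s\<close>. Differentiating termwise produces the coefficients
  \<open>(k + 1) / (2 k + 2 + j)!\<close>, and \<open>2 (k + 1) = (2 k + 2 + j) - j\<close> splits them into coefficients of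
  the tails \<open>j + 1\<close> and \<open>j + 2\<close>. No division by \<open>s\<close> occurs, so the formula covers \<open>s = 0\<close>.
\<close>

fun trig_tail_deriv :: "nat \<Rightarrow> nat \<Rightarrow> real \<Rightarrow> real" where
  "trig_tail_deriv 0 j s = trig_tail j s"
| "trig_tail_deriv (Suc n) j s =
    (real j * trig_tail_deriv n (j + 2) s - trig_tail_deriv n (j + 1) s) / 2"

lemma trig_tail_deriv_1:
  "trig_tail_deriv 1 j s = (real j * trig_tail (j + 2) s - trig_tail (j + 1) s) / 2"
  by simp

lemma diffs_trig_tail:
  "diffs (\<lambda>k. (- 1) ^ k / fact (2 * k + j)) k * s ^ k =
    (real j * ((- s) ^ k / fact (2 * k + (j + 2))) - (- s) ^ k / fact (2 * k + (j + 1))) / 2"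
proof -
  define f :: real where "f = fact (2 * k + (j + 1))"
  have f: "f \<noteq> 0" by (simp add: f_def)
  have f': "fact (2 * k + (j + 2)) = (2 * real k + j + 2) * f"
    "fact (2 * Suc k + j) = (2 * real k + j + 2) * f"
    by (simp_all add: f_def algebra_simps)
  have "2 * real k + j + 2 \<noteq> 0" by linarith
  with f show ?thesis
    unfolding diffs_def f' f_def[symmetric] power_minus[of s]
    by (simp add: divide_simps) (simp add: algebra_simps)
qed

lemma diffs_trig_tail_sums:
  "(\<lambda>k. diffs (\<lambda>k. (- 1) ^ k / fact (2 * k + j)) k * s ^ k) sums trig_tail_deriv 1 j s"
  unfolding diffs_trig_tail One_nat_def trig_tail_deriv.simps
  by (intro sums_divide sums_diff sums_mult trig_tail_sums)

lemma DERIV_trig_tail: "(trig_tail j has_real_derivative trig_tail_deriv 1 j s) (at s)"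
  using termdiffs_strong_converges_everywhere[OF summable_trig_tail[of j], of s]
    sums_unique[OF diffs_trig_tail_sums[of j s]]
  by (simp add: trig_tail_def[abs_def])

lemma DERIV_trig_tail_deriv:
  "(trig_tail_deriv n j has_real_derivative trig_tail_deriv (Suc n) j s) (at s)"
proof (induction n arbitrary: j)
  case 0
  have "trig_tail_deriv 0 j = trig_tail j" by auto
  then show ?case using DERIV_trig_tail[of j s] by simp
next
  case (Suc n)
  show ?case
    unfolding trig_tail_deriv.simps(2)[of n j, abs_def] trig_tail_deriv.simps(2)[of "Suc n" j]
    by (auto intro!: derivative_eq_intros Suc.IH simp del: trig_tail_deriv.simps)
qed

text \<open>
  These weights come from the factor \<open>k\<close> in the reduction of \<open>A\<^bsup>2k + n\<^esup>\<close>, which is due to the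
  double root of the annihilating polynomial of \<open>ad X\<close>.
\<close>

lemma trig_tail_weighted_sums:
  "(\<lambda>k. real k * (- s) ^ (k - 1) / fact (2 * k + j)) sums - trig_tail_deriv 1 j s"
proof -
  have "(\<lambda>k. real k * ((- 1) ^ k / fact (2 * k + j)) * s ^ (k - Suc 0)) sums trig_tail_deriv 1 j s"
    using diffs_equiv[OF sums_summable[OF diffs_trig_tail_sums[of j s]]]
      sums_unique[OF diffs_trig_tail_sums[of j s]] by simp
  moreover have "real k * (- s) ^ (k - 1) / fact (2 * k + j) = - (real k * ((- 1) ^ k / fact (2 * k + j)) * s ^ (k - Suc 0))" for k
    by (cases k) (auto simp: power_minus[of s])
  ultimately show ?thesis by (simp add: sums_minus)
qed

lemma trig_tail_0: "trig_tail 0 (t\<^sup>2) = cos t"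
proof -
  have "(\<lambda>k. (- (t\<^sup>2)) ^ k / fact (2 * k)) sums cos t"
    using cos_paired[of t] by (simp add: power_minus[of "t^2"] power_mult)
  then show ?thesis using sums_unique2[OF trig_tail_sums[of "t\<^sup>2" 0]] by simp
qed

lemma trig_tail_1: "trig_tail 1 (t\<^sup>2) = sinc t"
proof (cases "t = 0")
  case True
  then show ?thesis using trig_tail_rec[of 1 0] by simp
next
  case False
  have "(\<lambda>k. (- (t\<^sup>2)) ^ k / fact (2 * k + 1) * t) sums (trig_tail 1 (t\<^sup>2) * t)"
    by (intro sums_mult2 trig_tail_sums)
  moreover have "(\<lambda>k. (- (t\<^sup>2)) ^ k / fact (2 * k + 1) * t) sums sin t"
    using sin_paired[of t] by (simp add: power_minus[of "t^2"] power_mult power_mult_distrib mult_ac flip: power_mult)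
  ultimately have "trig_tail 1 (t\<^sup>2) * t = sin t" by (rule sums_unique2)
  with False show ?thesis by (simp add: field_simps)
qed

text \<open>
  For \<open>s = t\<^sup>2\<close> this is \<open>sin\<^sup>2 + cos\<^sup>2 = 1\<close>. The left side has derivative zero, which also
  covers negative \<open>s\<close>, as needed for two-sided derivatives at \<open>s = 0\<close>.
\<close>

lemma trig_tail_pythagoras: "(trig_tail 0 s)\<^sup>2 + s * (trig_tail 1 s)\<^sup>2 = 1"
proof -
  let ?K = "\<lambda>s. (trig_tail 0 s)\<^sup>2 + s * (trig_tail 1 s)\<^sup>2"
  have D: "(?K has_real_derivative 0) (at s)" for s
  proof -
    have "(?K has_real_derivative
        2 * (trig_tail_deriv 1 0 s * trig_tail 0 s) + ((trig_tail 1 s)\<^sup>2 +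
        2 * (trig_tail_deriv 1 1 s * trig_tail 1 s) * s)) (at s)"
      by (auto intro!: derivative_eq_intros DERIV_trig_tail)
    moreover have "2 * s * trig_tail_deriv 1 1 s = trig_tail 0 s - trig_tail 1 s"
      using trig_tail_rec[of 0 s] trig_tail_rec[of 1 s]
      by (simp add: numeral_2_eq_2 numeral_3_eq_3) (simp add: right_diff_distrib)
    then have "2 * (trig_tail_deriv 1 0 s * trig_tail 0 s) + ((trig_tail 1 s)\<^sup>2 +
        2 * (trig_tail_deriv 1 1 s * trig_tail 1 s) * s) = 0"
      by simp algebra
    ultimately show ?thesis by simp
  qed
  have "?K s = ?K 0" by (rule DERIV_isconst_all) (use D in blast)
  then show ?thesis using trig_tail_rec[of 0 0] by simp
qed

section \<open>The even part of the inverse series\<close>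

text \<open>
  The \<open>n\<close>-th derivative of \<open>(1 - \<gamma>) / s\<close>, where \<open>\<gamma> = (\<phi> / 2) cot (\<phi> / 2)\<close>. This function is the
  quotient of \<open>trig_tail 3 s / 2 - trig_tail 4 s\<close> by \<open>trig_tail 2 s = \<beta> / 2\<close>, a form without
  singularity at \<open>s = 0\<close>; the recursion solves the Leibniz rule for the product of quotient and
  denominator for the highest derivative.
\<close>

fun cot_deriv :: "nat \<Rightarrow> real \<Rightarrow> real" where
  "cot_deriv n s =
     (trig_tail_deriv n 3 s / 2 - trig_tail_deriv n 4 s -
      (\<Sum>k<n. real (n choose k) * (cot_deriv k s * trig_tail_deriv (n - k) 2 s))) / trig_tail 2 s"

declare cot_deriv.simps [simp del]

lemma cot_deriv_leibniz:
  assumes "trig_tail 2 s \<noteq> 0"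
  shows "(\<Sum>k\<le>n. real (n choose k) * (cot_deriv k s * trig_tail_deriv (n - k) 2 s)) =
     trig_tail_deriv n 3 s / 2 - trig_tail_deriv n 4 s"
proof -
  have "cot_deriv n s * trig_tail 2 s = trig_tail_deriv n 3 s / 2 - trig_tail_deriv n 4 s -
      (\<Sum>k<n. real (n choose k) * (cot_deriv k s * trig_tail_deriv (n - k) 2 s))"
    by (subst cot_deriv.simps) (use assms in simp)
  then show ?thesis by (simp flip: lessThan_Suc_atMost)
qed

lemma open_trig_tail_2: "open {s. trig_tail 2 s \<noteq> 0}"
proof -
  have "continuous_on UNIV (trig_tail 2)"
    by (rule DERIV_continuous_on) (use DERIV_trig_tail DERIV_subset in blast)
  then show ?thesis by (rule open_Collect_neq) (rule continuous_on_const)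
qed

text \<open>
  Three derivatives suffice: the plain coefficients contain the first one, and the Hessian
  differentiates them twice.
\<close>

lemma DERIV_cot_deriv:
  assumes s: "trig_tail 2 s \<noteq> 0" and n: "n < 3"
  shows "(cot_deriv n has_real_derivative cot_deriv (Suc n) s) (at s)"
proof -
  have s': "trig_tail_deriv 0 2 s \<noteq> 0" using s by simp
  note D = DERIV_trig_tail_deriv
  let ?F = "\<lambda>n. trig_tail_deriv n 2" and ?N = "\<lambda>n s. trig_tail_deriv n 3 s / 2 - trig_tail_deriv n 4 s"
  let ?B = cot_deriv
  have B0: "?B 0 s = ?N 0 s / ?F 0 s" for s
    by (subst cot_deriv.simps) simp
  have B1: "?B 1 s = (?N 1 s - ?B 0 s * ?F 1 s) / ?F 0 s" for s
    by (subst cot_deriv.simps) simp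
  have B2: "?B 2 s = (?N 2 s - ?B 0 s * ?F 2 s - 2 * (?B 1 s * ?F 1 s)) / ?F 0 s" for s
    by (subst cot_deriv.simps) (simp add: numeral_2_eq_2 lessThan_Suc del: trig_tail_deriv.simps(2))
  have B3: "?B 3 s = (?N 3 s - ?B 0 s * ?F 3 s - 3 * (?B 1 s * ?F 2 s) - 3 * (?B 2 s * ?F 1 s)) / ?F 0 s" for s
    by (subst cot_deriv.simps) (simp add: numeral_2_eq_2 numeral_3_eq_3 lessThan_Suc del: trig_tail_deriv.simps(2))
  \<comment> \<open>The quotient rule in the form \<open>(N / F)' = (N' - (N / F) F') / F\<close>, which matches the recursion.\<close>
  have quot: "(b has_real_derivative (N' - b s * ?F 1 s) / ?F 0 s) (at s)"
    if "(N has_real_derivative N') (at s)" "\<And>s. b s = N s / ?F 0 s" for b N N'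
  proof -
    have "((\<lambda>s. N s / ?F 0 s) has_real_derivative (N' * ?F 0 s - N s * ?F 1 s) / (?F 0 s * ?F 0 s)) (at s)"
      using DERIV_divide[OF that(1) D[of 0 2 s] s'] by simp
    moreover have "(N' * ?F 0 s - N s * ?F 1 s) / (?F 0 s * ?F 0 s) = (N' - b s * ?F 1 s) / ?F 0 s"
      using s' by (simp add: that(2) divide_simps del: trig_tail_deriv.simps)
    moreover have "b = (\<lambda>s. N s / ?F 0 s)" using that(2) by blast
    ultimately show ?thesis by metis
  qed
  have N: "(?N n has_real_derivative ?N (Suc n) s) (at s)" for n
    by (auto intro!: derivative_eq_intros D simp del: trig_tail_deriv.simps)
  have D0: "(?B 0 has_real_derivative ?B 1 s) (at s)"
    using quot[OF N[of 0] B0] unfolding B1[of s] by simp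
  have N1: "((\<lambda>s. ?N 1 s - ?B 0 s * ?F 1 s) has_real_derivative
      ?N 2 s - (?B 1 s * ?F 1 s + ?B 0 s * ?F 2 s)) (at s)"
    using DERIV_diff[OF N[of 1] DERIV_mult[OF D0 D[of 1 2]]]
    by (simp add: numeral_2_eq_2 mult.commute del: trig_tail_deriv.simps)
  have D1: "(?B 1 has_real_derivative ?B 2 s) (at s)"
    using quot[OF N1 B1] unfolding B2[of s] by (simp add: algebra_simps del: trig_tail_deriv.simps)
  have N2: "((\<lambda>s. ?N 2 s - ?B 0 s * ?F 2 s - 2 * (?B 1 s * ?F 1 s)) has_real_derivative
      ?N 3 s - (?B 1 s * ?F 2 s + ?B 0 s * ?F 3 s) - 2 * (?B 2 s * ?F 1 s + ?B 1 s * ?F 2 s)) (at s)"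
    using DERIV_diff[OF DERIV_diff[OF N[of 2] DERIV_mult[OF D0 D[of 2 2]]]
        DERIV_cmult[OF DERIV_mult[OF D1 D[of 1 2]], of 2]]
    by (simp add: numeral_2_eq_2 numeral_3_eq_3 algebra_simps del: trig_tail_deriv.simps)
  have D2: "(?B 2 has_real_derivative ?B 3 s) (at s)"
    using quot[OF N2 B2] unfolding B3[of s] by (simp add: algebra_simps del: trig_tail_deriv.simps)
  from n consider "n = 0" | "n = 1" | "n = 2" by linarith
  then show ?thesis
    by cases (use D0 D1 D2 in \<open>simp_all add: numeral_eq_Suc\<close>)
qed

text \<open>
  One of the two scalar identities behind \<open>dexp ** dexp_inv = 1\<close>. With \<open>w = i \<phi>\<close>, split the
  two series \<open>(e\<^sup>w - 1) / w\<close> and \<open>w / (e\<^sup>w - 1)\<close> as \<open>1 + w p + w\<^sup>2 q\<close> with \<open>p\<close> and \<open>q\<close>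
  even in \<open>w\<close>. Their product is 1; this is the part of that equation that is odd in \<open>w\<close>,
  divided by \<open>w\<close>.
\<close>

lemma inverse_odd_identity:
  assumes "trig_tail 2 s \<noteq> 0"
  shows "trig_tail 2 s - 1 / 2 - s * (trig_tail 2 s * cot_deriv 0 s) + s * trig_tail 3 s / 2 = 0"
proof -
  have "trig_tail 2 s * cot_deriv 0 s = trig_tail 3 s / 2 - trig_tail 4 s"
    using cot_deriv_leibniz[OF assms, of 0] by (simp add: mult.commute)
  moreover have "trig_tail 2 s = 1 / 2 - s * trig_tail 4 s"
    using trig_tail_rec[of 2 s] by (simp add: fact_numeral)
  ultimately show ?thesis by algebra
qed

text \<open>
  The Pythagorean identity written in the tails 2, 3 and 4. Its terms of order below two in \<open>s\<close>
  cancel, and \<open>s\<^sup>2\<close> is divided out.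
\<close>

lemma trig_tail_quadratic:
  "2 * trig_tail 4 s + (trig_tail 2 s)\<^sup>2 - 2 * trig_tail 3 s + s * (trig_tail 3 s)\<^sup>2 = 0"
proof (cases "s = 0")
  case True
  have v: "trig_tail 2 0 = 1 / 2" "trig_tail 3 0 = 1 / 6" "trig_tail 4 0 = 1 / 24"
    using trig_tail_rec[of 2 0] trig_tail_rec[of 3 0] trig_tail_rec[of 4 0]
    by (simp_all add: fact_numeral)
  show ?thesis unfolding True v by (simp add: power2_eq_square)
next
  case False
  have "trig_tail 0 s = 1 - s * trig_tail 2 s" "trig_tail 1 s = 1 - s * trig_tail 3 s"
    "trig_tail 2 s = 1 / 2 - s * trig_tail 4 s"
    using trig_tail_rec[of 0 s] trig_tail_rec[of 1 s] trig_tail_rec[of 2 s]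
    by (simp_all add: fact_numeral numeral_eq_Suc)
  with trig_tail_pythagoras[of s]
  have "s * (2 * trig_tail 4 s + (trig_tail 2 s)\<^sup>2 - 2 * trig_tail 3 s + s * (trig_tail 3 s)\<^sup>2) = 0"
    by algebra
  with False show ?thesis by simp
qed

text \<open>
  The companion of \<open>inverse_odd_identity\<close>: the part of the same equation that is even in \<open>w\<close>,
  divided by \<open>w\<^sup>2\<close>.
\<close>

lemma inverse_even_identity:
  assumes "trig_tail 2 s \<noteq> 0"
  shows "trig_tail 3 s + cot_deriv 0 s - trig_tail 2 s / 2 - s * (trig_tail 3 s * cot_deriv 0 s) = 0"
proof -
  have "trig_tail 2 s * cot_deriv 0 s = trig_tail 3 s / 2 - trig_tail 4 s"
    using cot_deriv_leibniz[OF assms, of 0] by (simp add: mult.commute)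
  moreover have "trig_tail 2 s = 1 / 2 - s * trig_tail 4 s"
    using trig_tail_rec[of 2 s] by (simp add: fact_numeral)
  moreover note trig_tail_quadratic[of s]
  ultimately have "trig_tail 2 s * (trig_tail 3 s + cot_deriv 0 s - trig_tail 2 s / 2
      - s * (trig_tail 3 s * cot_deriv 0 s)) = 0"
    by algebra
  with assms show ?thesis by simp
qed

lemma DERIV_zero_on_open:
  assumes "open U" "(s::real) \<in> U" "\<And>r. r \<in> U \<Longrightarrow> f r = (0::real)" "(f has_real_derivative d) (at s)"
  shows "d = 0"
proof -
  have "((\<lambda>_. 0) has_real_derivative d) (at s)"
    by (rule has_field_derivative_transform_within_open[OF assms(4,1,2)]) (use assms(3) in simp)
  then show ?thesis using DERIV_unique DERIV_const by blast
qed

text \<open>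
  The Riccati equation of the cotangent. It and its two derivatives express the
  derivatives of \<open>(1 - \<gamma>) / s\<close> through \<open>\<gamma>\<close> and \<open>s\<close>, as in the closed forms of the coefficients.
\<close>

lemma cot_deriv_riccati:
  assumes s: "trig_tail 2 s \<noteq> 0"
  shows "2 * (s * cot_deriv 1 s) + 3 * cot_deriv 0 s - s * (cot_deriv 0 s)\<^sup>2 - 1 / 4 = 0"
proof -
  have "trig_tail 2 s * cot_deriv 0 s = trig_tail 3 s / 2 - trig_tail 4 s"
    using cot_deriv_leibniz[OF s, of 0] by (simp add: mult.commute)
  moreover have "cot_deriv 0 s * trig_tail_deriv 1 2 s + cot_deriv 1 s * trig_tail 2 s =
      trig_tail_deriv 1 3 s / 2 - trig_tail_deriv 1 4 s"
    using cot_deriv_leibniz[OF s, of 1] by simp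
  moreover have "trig_tail_deriv 1 2 s = trig_tail 4 s - trig_tail 3 s / 2"
    "trig_tail_deriv 1 3 s = 3 * trig_tail 5 s / 2 - trig_tail 4 s / 2"
    "trig_tail_deriv 1 4 s = 2 * trig_tail 6 s - trig_tail 5 s / 2"
    unfolding trig_tail_deriv_1 by simp_all
  moreover have "trig_tail 2 s = 1 / 2 - s * trig_tail 4 s"
    "trig_tail 3 s = 1 / 6 - s * trig_tail 5 s" "trig_tail 4 s = 1 / 24 - s * trig_tail 6 s"
    using trig_tail_rec[of 2 s] trig_tail_rec[of 3 s] trig_tail_rec[of 4 s]
    by (simp_all add: fact_numeral)
  moreover note inverse_even_identity[OF s]
  ultimately have "trig_tail 2 s * (2 * (s * cot_deriv 1 s) + 3 * cot_deriv 0 s - s * (cot_deriv 0 s)\<^sup>2 - 1 / 4) = 0"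
    by algebra
  with s show ?thesis by simp
qed

lemma cot_deriv_riccati':
  assumes s: "trig_tail 2 s \<noteq> 0"
  shows "2 * (s * cot_deriv 2 s) + 5 * cot_deriv 1 s - (cot_deriv 0 s)\<^sup>2
    - 2 * (s * (cot_deriv 0 s * cot_deriv 1 s)) = 0"
proof (rule DERIV_zero_on_open[OF open_trig_tail_2, of s])
  show "((\<lambda>s. 2 * (s * cot_deriv 1 s) + 3 * cot_deriv 0 s - s * (cot_deriv 0 s)\<^sup>2 - 1 / 4)
      has_real_derivative 2 * (s * cot_deriv 2 s) + 5 * cot_deriv 1 s - (cot_deriv 0 s)\<^sup>2
    - 2 * (s * (cot_deriv 0 s * cot_deriv 1 s))) (at s)"
    using DERIV_cot_deriv[OF s, of 0] DERIV_cot_deriv[OF s, of 1]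
    by (auto intro!: derivative_eq_intros simp: numeral_2_eq_2)
qed (use s cot_deriv_riccati in auto)

lemma cot_deriv_riccati'':
  assumes s: "trig_tail 2 s \<noteq> 0"
  shows "2 * (s * cot_deriv 3 s) + 7 * cot_deriv 2 s - 4 * (cot_deriv 0 s * cot_deriv 1 s)
    - 2 * (s * ((cot_deriv 1 s)\<^sup>2 + cot_deriv 0 s * cot_deriv 2 s)) = 0"
proof (rule DERIV_zero_on_open[OF open_trig_tail_2, of s])
  show "((\<lambda>s. 2 * (s * cot_deriv 2 s) + 5 * cot_deriv 1 s - (cot_deriv 0 s)\<^sup>2
    - 2 * (s * (cot_deriv 0 s * cot_deriv 1 s))) has_real_derivative
    2 * (s * cot_deriv 3 s) + 7 * cot_deriv 2 s - 4 * (cot_deriv 0 s * cot_deriv 1 s)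
    - 2 * (s * ((cot_deriv 1 s)\<^sup>2 + cot_deriv 0 s * cot_deriv 2 s))) (at s)"
    using DERIV_cot_deriv[OF s, of 0] DERIV_cot_deriv[OF s, of 1] DERIV_cot_deriv[OF s, of 2]
    by (auto intro!: derivative_eq_intros simp: numeral_2_eq_2 numeral_3_eq_3 power2_eq_square algebra_simps)
qed (use s cot_deriv_riccati' in auto)

text \<open>
  The inverse of \<open>dexp\<close> needs the two identities to first order in \<open>s\<close>, because \<open>-A\<^sup>2\<close> differs
  from \<open>s\<close> by a matrix that is nilpotent on the range of \<open>A\<close>.
\<close>

lemma inverse_odd_identity':
  assumes s: "trig_tail 2 s \<noteq> 0"
  shows "trig_tail_deriv 1 2 s - trig_tail 2 s * cot_deriv 0 s
    - s * (trig_tail_deriv 1 2 s * cot_deriv 0 s + trig_tail 2 s * cot_deriv 1 s)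
    + trig_tail 3 s / 2 + s * trig_tail_deriv 1 3 s / 2 = 0"
proof (rule DERIV_zero_on_open[OF open_trig_tail_2, of s])
  show "((\<lambda>s. trig_tail 2 s - 1 / 2 - s * (trig_tail 2 s * cot_deriv 0 s) + s * trig_tail 3 s / 2)
     has_real_derivative trig_tail_deriv 1 2 s - trig_tail 2 s * cot_deriv 0 s
    - s * (trig_tail_deriv 1 2 s * cot_deriv 0 s + trig_tail 2 s * cot_deriv 1 s)
    + trig_tail 3 s / 2 + s * trig_tail_deriv 1 3 s / 2) (at s)"
    using DERIV_cot_deriv[OF s, of 0] DERIV_trig_tail[of 2 s] DERIV_trig_tail[of 3 s]
    by (auto intro!: derivative_eq_intros simp: field_simps simp del: trig_tail_deriv.simps)
qed (use s inverse_odd_identity in auto)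

lemma inverse_even_identity':
  assumes s: "trig_tail 2 s \<noteq> 0"
  shows "trig_tail_deriv 1 3 s + cot_deriv 1 s - trig_tail_deriv 1 2 s / 2 - trig_tail 3 s * cot_deriv 0 s
    - s * (trig_tail_deriv 1 3 s * cot_deriv 0 s + trig_tail 3 s * cot_deriv 1 s) = 0"
proof (rule DERIV_zero_on_open[OF open_trig_tail_2, of s])
  show "((\<lambda>s. trig_tail 3 s + cot_deriv 0 s - trig_tail 2 s / 2 - s * (trig_tail 3 s * cot_deriv 0 s))
     has_real_derivative trig_tail_deriv 1 3 s + cot_deriv 1 s - trig_tail_deriv 1 2 s / 2
    - trig_tail 3 s * cot_deriv 0 s
    - s * (trig_tail_deriv 1 3 s * cot_deriv 0 s + trig_tail 3 s * cot_deriv 1 s)) (at s)"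
    using DERIV_cot_deriv[OF s, of 0] DERIV_trig_tail[of 2 s] DERIV_trig_tail[of 3 s]
    by (auto intro!: derivative_eq_intros simp: field_simps simp del: trig_tail_deriv.simps)
qed (use s inverse_even_identity in auto)

section \<open>The coefficient functions\<close>

text \<open>
  In the variable \<open>\<phi>\<close> this is \<open>(\<phi>\<^sup>j T\<^sub>j)' = \<phi>\<^bsup>j - 1\<^esup> T\<^bsub>j - 1\<^esub>\<close>, differentiated \<open>n\<close> times in \<open>s\<close>. Solved
  for the highest derivative it reduces everything to \<open>\<alpha>\<close>, \<open>\<beta>\<close> and \<open>s\<close> when \<open>s \<noteq> 0\<close>.
\<close>

lemma trig_tail_deriv_euler:
  "2 * s * trig_tail_deriv (Suc n) (Suc j) s =
    trig_tail_deriv n j s - real (2 * n + j + 1) * trig_tail_deriv n (Suc j) s"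
proof (induction n arbitrary: j)
  case 0
  define c :: real where "c = 1 / fact (Suc j)"
  have "1 / fact j = real (Suc j) * c"
    unfolding c_def fact_Suc by (simp del: of_nat_Suc)
  then have "trig_tail j s = real (Suc j) * c - s * trig_tail (Suc (Suc j)) s"
    "trig_tail (Suc j) s = c - s * trig_tail (Suc (Suc (Suc j))) s"
    using trig_tail_rec[of j s] trig_tail_rec[of "Suc j" s] by (simp_all add: c_def del: of_nat_Suc)
  then show ?case by simp (simp add: algebra_simps)
next
  case (Suc n)
  have "2 * s * trig_tail_deriv (Suc (Suc n)) (Suc j) s =
     (real (j + 1) * (2 * s * trig_tail_deriv (Suc n) (Suc (j + 2)) s)
       - 2 * s * trig_tail_deriv (Suc n) (Suc (j + 1)) s) / 2"
    unfolding trig_tail_deriv.simps(2)[of "Suc n" "Suc j"] by (simp add: field_simps del: trig_tail_deriv.simps)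
  also have "\<dots> = trig_tail_deriv (Suc n) j s - real (2 * Suc n + j + 1) * trig_tail_deriv (Suc n) (Suc j) s"
    unfolding Suc.IH trig_tail_deriv.simps(2)[of n j] trig_tail_deriv.simps(2)[of n "Suc j"]
    by (simp add: field_simps del: trig_tail_deriv.simps)
  finally show ?case .
qed

text \<open>
  Arguments \<open>p n\<close> and \<open>q n\<close> are the \<open>n\<close>-th derivatives of the odd and even parts \<open>p\<close> and \<open>q\<close> of a
  series \<open>1 + A p(-A\<^sup>2) + A\<^sup>2 q(-A\<^sup>2)\<close>; the values are the coefficients after reduction to degree 4.
\<close>

definition ad_coeff :: "(nat \<Rightarrow> real \<Rightarrow> real) \<Rightarrow> (nat \<Rightarrow> real \<Rightarrow> real) \<Rightarrow> nat \<Rightarrow> real \<Rightarrow> real" where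
  "ad_coeff p q i s =
    (if i = 1 then p 0 s - s * p 1 s
     else if i = 2 then q 0 s - s * q 1 s
     else if i = 3 then - p 1 s
     else if i = 4 then - q 1 s
     else 0)"

text \<open>
  The bar stands for \<open>(1 / \<phi>) d/d\<phi> = 2 d/ds\<close>, and so does the passage from bar to breve.
\<close>

definition ad_coeff_bar :: "(nat \<Rightarrow> real \<Rightarrow> real) \<Rightarrow> (nat \<Rightarrow> real \<Rightarrow> real) \<Rightarrow> nat \<Rightarrow> real \<Rightarrow> real" where
  "ad_coeff_bar p q i s =
    (if i = 1 then - 2 * s * p 2 s
     else if i = 2 then - 2 * s * q 2 s
     else if i = 3 then - 2 * p 2 s
     else if i = 4 then - 2 * q 2 s
     else 0)"

definition ad_coeff_breve :: "(nat \<Rightarrow> real \<Rightarrow> real) \<Rightarrow> (nat \<Rightarrow> real \<Rightarrow> real) \<Rightarrow> nat \<Rightarrow> real \<Rightarrow> real" where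
  "ad_coeff_breve p q i s =
    (if i = 1 then - 4 * p 2 s - 4 * s * p 3 s
     else if i = 2 then - 4 * q 2 s - 4 * s * q 3 s
     else if i = 3 then - 4 * p 3 s
     else if i = 4 then - 4 * q 3 s
     else 0)"

lemma DERIV_ad_coeff:
  assumes "\<And>n. n < 3 \<Longrightarrow> (p n has_real_derivative p (Suc n) s) (at s)"
    and "\<And>n. n < 3 \<Longrightarrow> (q n has_real_derivative q (Suc n) s) (at s)"
  shows "(ad_coeff p q i has_real_derivative ad_coeff_bar p q i s / 2) (at s)"
    and "(ad_coeff_bar p q i has_real_derivative ad_coeff_breve p q i s / 2) (at s)"
  unfolding ad_coeff_def[abs_def] ad_coeff_bar_def[abs_def] ad_coeff_breve_def
  using assms(1)[of 0] assms(1)[of 1] assms(1)[of 2] assms(2)[of 0] assms(2)[of 1] assms(2)[of 2]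
  by (auto intro!: derivative_eq_intros simp: numeral_2_eq_2 numeral_3_eq_3)

abbreviation "dexp_odd \<equiv> \<lambda>n. trig_tail_deriv n 2"
abbreviation "dexp_even \<equiv> \<lambda>n. trig_tail_deriv n 3"

definition inv_odd :: "nat \<Rightarrow> real \<Rightarrow> real" where
  "inv_odd n s = (if n = 0 then - 1 / 2 else 0)"

text \<open>
  Reduces each coefficient to a computation at nonzero arguments: where the closed form is
  singular, its limit is the value of the continuous function that it agrees with nearby.
\<close>

lemma extend0_eqI:
  assumes "isCont g 0" "\<forall>\<^sub>F t in at 0. f t = g t" "t \<noteq> 0 \<Longrightarrow> f t = g t"
  shows "extend0 f t = g t"
proof -
  have "(f \<longlongrightarrow> g 0) (at 0)"
    using assms(1,2) by (simp add: isCont_def tendsto_cong)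
  then show ?thesis using assms(3) by (auto simp: extend0_def tendsto_Lim)
qed

lemma isCont_square: "isCont f (0::real) \<Longrightarrow> isCont (\<lambda>t. f (t\<^sup>2)) (0::real)"
  by (rule isCont_o2[where g = f]) auto

lemma beta_eq: "beta t = 2 * trig_tail 2 (t\<^sup>2)"
proof (cases "t = 0")
  case True
  then show ?thesis using trig_tail_rec[of 2 0] by (simp add: beta_def fact_numeral)
next
  case False
  have "cos t = 1 - 2 * (sin (t / 2))\<^sup>2" using cos_double_sin[of "t / 2"] by simp
  moreover have "cos t = 1 - t\<^sup>2 * trig_tail 2 (t\<^sup>2)"
    using trig_tail_rec[of 0 "t\<^sup>2"] trig_tail_0[of t] by (simp add: numeral_eq_Suc)
  ultimately show ?thesis using False by (simp add: beta_def power_divide divide_simps)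
qed

lemma alpha_eq: "alpha t = trig_tail 1 (t\<^sup>2)"
  unfolding alpha_def trig_tail_1 ..

text \<open>
  Here \<open>trig_tail 1 s = \<alpha>\<close> and \<open>trig_tail 2 s = \<beta> / 2\<close>. The repeated subterm
  \<open>(1 - s * trig_tail 2 s - trig_tail 1 s) / (2 * s)\<close> is the derivative of \<open>\<alpha>\<close>.
\<close>

lemma dexp_derivs:
  assumes "s \<noteq> 0"
  shows "trig_tail 3 s = (1 - trig_tail 1 s) / s"
    and "dexp_odd 1 s = (trig_tail 1 s - 2 * trig_tail 2 s) / (2 * s)"
    and "dexp_odd 2 s = ((1 - s * trig_tail 2 s - trig_tail 1 s) / (2 * s) - 4 * dexp_odd 1 s) / (2 * s)"
    and "dexp_odd 3 s = ((- trig_tail 1 s / 2 - 3 * ((1 - s * trig_tail 2 s - trig_tail 1 s) / (2 * s))) / (2 * s)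
      - 6 * dexp_odd 2 s) / (2 * s)"
    and "dexp_even 1 s = (trig_tail 2 s - 3 * trig_tail 3 s) / (2 * s)"
    and "dexp_even 2 s = (dexp_odd 1 s - 5 * dexp_even 1 s) / (2 * s)"
    and "dexp_even 3 s = (dexp_odd 2 s - 7 * dexp_even 2 s) / (2 * s)"
proof -
  let ?D = trig_tail_deriv
  have E: "?D (Suc n) (Suc j) s = (?D n j s - real (2 * n + j + 1) * ?D n (Suc j) s) / (2 * s)" for n j
    using trig_tail_deriv_euler[of s n j] assms by (simp add: field_simps del: trig_tail_deriv.simps)
  show "trig_tail 3 s = (1 - trig_tail 1 s) / s"
    using trig_tail_rec[of 1 s] assms by (simp add: numeral_eq_Suc field_simps)
  have P0: "?D 0 0 s = 1 - s * trig_tail 2 s"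
    using trig_tail_rec[of 0 s] by (simp add: numeral_eq_Suc)
  have c1: "?D 1 0 s = - trig_tail 1 s / 2" by simp
  have a1: "?D 1 1 s = (1 - s * trig_tail 2 s - trig_tail 1 s) / (2 * s)"
    using E[of 0 0] unfolding P0 by (simp del: trig_tail_deriv.simps(2))
  have a2: "?D 2 1 s = (- trig_tail 1 s / 2 - 3 * ((1 - s * trig_tail 2 s - trig_tail 1 s) / (2 * s))) / (2 * s)"
    using E[of 1 0] a1 c1 by (simp add: numeral_2_eq_2 del: trig_tail_deriv.simps)
  show "dexp_odd 1 s = (trig_tail 1 s - 2 * trig_tail 2 s) / (2 * s)"
    using E[of 0 1] by (simp add: numeral_2_eq_2 del: trig_tail_deriv.simps(2))
  show "dexp_odd 2 s = ((1 - s * trig_tail 2 s - trig_tail 1 s) / (2 * s) - 4 * dexp_odd 1 s) / (2 * s)"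
    using E[of 1 1] unfolding a1[symmetric] by (simp add: numeral_2_eq_2 del: trig_tail_deriv.simps)
  show "dexp_odd 3 s = ((- trig_tail 1 s / 2 - 3 * ((1 - s * trig_tail 2 s - trig_tail 1 s) / (2 * s))) / (2 * s)
      - 6 * dexp_odd 2 s) / (2 * s)"
    using E[of 2 1] unfolding a2[symmetric] by (simp add: numeral_2_eq_2 numeral_3_eq_3 del: trig_tail_deriv.simps)
  show "dexp_even 1 s = (trig_tail 2 s - 3 * trig_tail 3 s) / (2 * s)"
    using E[of 0 2] by (simp add: numeral_2_eq_2 numeral_3_eq_3 del: trig_tail_deriv.simps(2))
  show "dexp_even 2 s = (dexp_odd 1 s - 5 * dexp_even 1 s) / (2 * s)"
    using E[of 1 2] by (simp add: numeral_2_eq_2 numeral_3_eq_3 del: trig_tail_deriv.simps)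
  show "dexp_even 3 s = (dexp_odd 2 s - 7 * dexp_even 2 s) / (2 * s)"
    using E[of 2 2] by (simp add: numeral_2_eq_2 numeral_3_eq_3 del: trig_tail_deriv.simps)
qed

lemma even_powers: "t ^ 4 = (t\<^sup>2) ^ 2" "t ^ 6 = (t\<^sup>2) ^ 3" "t ^ 8 = (t\<^sup>2) ^ 4" for t :: real
  by simp_all

lemma isCont_dexp_coeffs:
  "isCont (ad_coeff dexp_odd dexp_even i) s"
  "isCont (ad_coeff_bar dexp_odd dexp_even i) s"
  "isCont (ad_coeff_breve dexp_odd dexp_even i) s"
proof -
  note D = DERIV_ad_coeff[of dexp_odd s dexp_even, OF DERIV_trig_tail_deriv DERIV_trig_tail_deriv]
  show "isCont (ad_coeff dexp_odd dexp_even i) s" "isCont (ad_coeff_bar dexp_odd dexp_even i) s"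
    using D DERIV_isCont by blast+
  have "isCont (trig_tail_deriv n j) s" for n j
    using DERIV_trig_tail_deriv DERIV_isCont by blast
  then show "isCont (ad_coeff_breve dexp_odd dexp_even i) s"
    unfolding ad_coeff_breve_def[abs_def]
    by (cases "i = 1"; cases "i = 2"; cases "i = 3"; cases "i = 4")
      (auto intro!: continuous_intros simp del: trig_tail_deriv.simps)
qed

lemma coeff_a_eq: "coeff_a i t = ad_coeff dexp_odd dexp_even i (t\<^sup>2)"
proof -
  have *: "(let \<alpha> = alpha t; \<beta> = beta t; \<delta> = delta t in
     if i = 1 then \<beta> - \<alpha> / 2
     else if i = 2 then 1 / 2 * (5 * \<delta> - \<beta> / 2)
     else if i = 3 then 1 / (2 * t^2) * (\<beta> - \<alpha>)
     else if i = 4 then 1 / (2 * t^2) * (3 * \<delta> - \<beta> / 2)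
     else 0) = ad_coeff dexp_odd dexp_even i (t\<^sup>2)" if t: "t \<noteq> 0" for t
  proof -
    define s where "s = t\<^sup>2"
    have s: "s \<noteq> 0" using t by (simp add: s_def)
    \<comment> \<open>\<open>delta\<close> is itself an extension, but its argument is nonzero here.\<close>
    have d: "delta t = (1 - trig_tail 1 s) / s"
      using t by (simp add: delta_def extend0_def alpha_eq s_def)
    show ?thesis
      unfolding Let_def d alpha_eq beta_eq ad_coeff_def s_def[symmetric] dexp_derivs[OF s] trig_tail_deriv.simps(1)
      using s by (simp add: field_simps power2_eq_square)
  qed
  show ?thesis
    unfolding coeff_a_def
    by (rule extend0_eqI[where g = "\<lambda>t. ad_coeff dexp_odd dexp_even i (t\<^sup>2)"])
      (use * in \<open>auto simp: eventually_at_filter intro!: isCont_square isCont_dexp_coeffs always_eventually\<close>)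
qed

lemma coeff_a_bar_eq: "coeff_a_bar i t = ad_coeff_bar dexp_odd dexp_even i (t\<^sup>2)"
proof -
  have *: "(let \<alpha> = alpha t; \<beta> = beta t;
         a1 = 1 / 4 * \<beta> + 1 / t^2 * (5 / 2 * \<alpha> - 2 * \<beta> - 1 / 2);
         a2 = 1 / t^2 * (7 / 4 * \<beta> - 1 / 2 * \<alpha>) + 15 / (2 * t^4) * (\<alpha> - 1) in
     if i = 1 then a1
     else if i = 2 then a2
     else if i = 3 then a1 / t^2
     else if i = 4 then a2 / t^2
     else 0) = ad_coeff_bar dexp_odd dexp_even i (t\<^sup>2)" if t: "t \<noteq> 0" for t
  proof -
    define s where "s = t\<^sup>2"
    have s: "s \<noteq> 0" using t by (simp add: s_def)
    show ?thesis
      unfolding Let_def even_powers alpha_eq beta_eq ad_coeff_bar_def s_def[symmetric] dexp_derivs[OF s]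
      using s by (simp add: field_simps power2_eq_square)
  qed
  show ?thesis
    unfolding coeff_a_bar_def
    by (rule extend0_eqI[where g = "\<lambda>t. ad_coeff_bar dexp_odd dexp_even i (t\<^sup>2)"])
      (use * in \<open>auto simp: eventually_at_filter intro!: isCont_square isCont_dexp_coeffs always_eventually\<close>)
qed

lemma coeff_a_breve_eq: "coeff_a_breve i t = ad_coeff_breve dexp_odd dexp_even i (t\<^sup>2)"
proof -
  have *: "(let \<alpha> = alpha t; \<beta> = beta t in
     if i = 1 then
       1 / t^2 * (\<alpha> / 2 - 7 / 4 * \<beta>) + 1 / t^4 * (7 / 2 - 23 / 2 * \<alpha> + 8 * \<beta>)
     else if i = 2 then
       \<beta> / (4 * t^2) + 1 / t^4 * (5 * \<alpha> - 43 / 4 * \<beta> - 1 / 2) + 75 / (2 * t^6) * (1 - \<alpha>)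
     else if i = 3 then
       1 / t^4 * (1 / 2 * \<alpha> - 9 / 4 * \<beta>) + 1 / t^6 * (9 / 2 - 33 / 2 * \<alpha> + 12 * \<beta>)
     else if i = 4 then
       \<beta> / (4 * t^4) + 1 / t^6 * (6 * \<alpha> - 1 / 2 - 57 / 4 * \<beta>) + 105 / (2 * t^8) * (1 - \<alpha>)
     else 0) = ad_coeff_breve dexp_odd dexp_even i (t\<^sup>2)" if t: "t \<noteq> 0" for t
  proof -
    define s where "s = t\<^sup>2"
    have s: "s \<noteq> 0" using t by (simp add: s_def)
    show ?thesis
      unfolding Let_def even_powers alpha_eq beta_eq ad_coeff_breve_def s_def[symmetric] dexp_derivs[OF s]
      using s by (simp add: field_simps eval_nat_numeral)
  qed
  show ?thesis
    unfolding coeff_a_breve_def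
    by (rule extend0_eqI[where g = "\<lambda>t. ad_coeff_breve dexp_odd dexp_even i (t\<^sup>2)"])
      (use * in \<open>auto simp: eventually_at_filter intro!: isCont_square isCont_dexp_coeffs always_eventually\<close>)
qed

lemma cot_deriv_riccati_solved:
  assumes "s \<noteq> 0" "trig_tail 2 s \<noteq> 0"
  shows "cot_deriv 1 s = (s * (cot_deriv 0 s)\<^sup>2 + 1 / 4 - 3 * cot_deriv 0 s) / (2 * s)"
    and "cot_deriv 2 s = ((cot_deriv 0 s)\<^sup>2 + 2 * (s * (cot_deriv 0 s * cot_deriv 1 s)) - 5 * cot_deriv 1 s) / (2 * s)"
    and "cot_deriv 3 s = (4 * (cot_deriv 0 s * cot_deriv 1 s)
      + 2 * (s * ((cot_deriv 1 s)\<^sup>2 + cot_deriv 0 s * cot_deriv 2 s)) - 7 * cot_deriv 2 s) / (2 * s)"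
  using cot_deriv_riccati[OF assms(2)] cot_deriv_riccati'[OF assms(2)] cot_deriv_riccati''[OF assms(2)] assms(1)
  by (simp_all add: divide_simps) (simp_all add: algebra_simps)

text \<open>
  With \<open>\<gamma> = (\<phi> / 2) cot (\<phi> / 2)\<close> and \<open>\<beta> = (sin (\<phi> / 2) / (\<phi> / 2))\<^sup>2\<close> the formula for \<open>1 / \<beta>\<close> is
  \<open>1 / sin\<^sup>2 = 1 + cot\<^sup>2\<close>; it turns the coefficients of the inverse into polynomials in \<open>\<gamma>\<close> and \<open>s\<close>
  over powers of \<open>s\<close>.
\<close>

lemma gam_identities:
  assumes t: "t \<noteq> 0" and \<beta>: "beta t \<noteq> 0"
  shows "cot_deriv 0 (t\<^sup>2) = (1 - gam t) / t\<^sup>2" and "1 / beta t = (gam t)\<^sup>2 + t\<^sup>2 / 4"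
    and "alpha t / beta t = gam t"
proof -
  define s where "s = t\<^sup>2"
  have s: "s \<noteq> 0" using t by (simp add: s_def)
  define F where "F = trig_tail 2 s"
  have F: "F \<noteq> 0" "trig_tail 2 s \<noteq> 0" using \<beta> by (simp_all add: beta_eq s_def F_def)
  define \<alpha> where "\<alpha> = trig_tail 1 s"
  have "trig_tail 0 s = 1 - s * F" "\<alpha> = 1 - s * trig_tail 3 s" "F = 1 / 2 - s * trig_tail 4 s"
    using trig_tail_rec[of 0 s] trig_tail_rec[of 1 s] trig_tail_rec[of 2 s]
    by (simp_all add: fact_numeral numeral_eq_Suc F_def \<alpha>_def)
  note r = this
  have g: "gam t = \<alpha> / (2 * F)" by (simp add: gam_def alpha_eq beta_eq s_def F_def \<alpha>_def)
  have "F * cot_deriv 0 s = trig_tail 3 s / 2 - trig_tail 4 s"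
    using cot_deriv_leibniz[OF F(2), of 0] by (simp add: mult.commute F_def)
  with r have "2 * F * (s * cot_deriv 0 s) = 2 * F - \<alpha>" by algebra
  then show "cot_deriv 0 (t\<^sup>2) = (1 - gam t) / t\<^sup>2"
    using s F unfolding g s_def[symmetric] by (simp add: field_simps)
  have "(1 - s * F)\<^sup>2 + s * \<alpha>\<^sup>2 = 1"
    using trig_tail_pythagoras[of s] r(1) by (simp add: \<alpha>_def)
  then have "s * (s * F\<^sup>2 + \<alpha>\<^sup>2) = s * (2 * F)"
    by algebra
  with s have "s * F\<^sup>2 + \<alpha>\<^sup>2 = 2 * F" by simp
  then show "1 / beta t = (gam t)\<^sup>2 + t\<^sup>2 / 4"
    using F unfolding g s_def[symmetric] beta_eq F_def[symmetric]
    by (simp add: divide_simps power2_eq_square)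
  show "alpha t / beta t = gam t" by (simp add: gam_def)
qed

lemma isCont_cot_deriv:
  assumes "trig_tail 2 s \<noteq> 0"
  shows "isCont (cot_deriv n) s"
proof (induction n rule: less_induct)
  case (less n)
  have "isCont (trig_tail_deriv m j) s" for m j
    using DERIV_trig_tail_deriv DERIV_isCont by blast
  moreover have "isCont (trig_tail j) s" for j
    using DERIV_trig_tail DERIV_isCont by blast
  ultimately show ?case
    unfolding cot_deriv.simps[of n, abs_def]
    using assms less by (auto intro!: continuous_intros simp del: trig_tail_deriv.simps)
qed

lemma DERIV_inv_odd: "(inv_odd n has_real_derivative inv_odd (Suc n) s) (at s)"
  by (cases n) (auto simp: inv_odd_def[abs_def])

lemma isCont_inv_coeffs:
  assumes "trig_tail 2 s \<noteq> 0"
  shows "isCont (ad_coeff inv_odd cot_deriv i) s"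
    "isCont (ad_coeff_bar inv_odd cot_deriv i) s"
    "isCont (ad_coeff_breve inv_odd cot_deriv i) s"
proof -
  have "isCont (inv_odd n) s" for n
    using DERIV_inv_odd DERIV_isCont by blast
  note c = this isCont_cot_deriv[OF assms]
  show "isCont (ad_coeff inv_odd cot_deriv i) s"
    "isCont (ad_coeff_bar inv_odd cot_deriv i) s"
    "isCont (ad_coeff_breve inv_odd cot_deriv i) s"
    unfolding ad_coeff_def[abs_def] ad_coeff_bar_def[abs_def] ad_coeff_breve_def[abs_def] using c
    by (cases "i = 1"; cases "i = 2"; cases "i = 3"; cases "i = 4"; auto intro!: continuous_intros)+
qed

lemma beta_nonzero_near_0: "\<forall>\<^sub>F t in at 0. t \<noteq> 0 \<and> beta t \<noteq> 0"
proof -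
  have "isCont (trig_tail 2) 0" using DERIV_trig_tail DERIV_isCont by blast
  then have "isCont beta 0"
    unfolding beta_eq[abs_def] by (intro isCont_square[of "\<lambda>s. 2 * trig_tail 2 s"] continuous_intros)
  moreover have "beta 0 \<noteq> 0" by (simp add: beta_def)
  ultimately have "\<forall>\<^sub>F t in at 0. beta t \<noteq> 0"
    unfolding isCont_def by (rule tendsto_imp_eventually_ne)
  moreover have "\<forall>\<^sub>F t in at 0. t \<noteq> (0::real)" by (simp add: eventually_at_filter)
  ultimately show ?thesis by eventually_elim simp
qed

lemma coeff_b_eq:
  assumes "beta t \<noteq> 0"
  shows "coeff_b i t = ad_coeff inv_odd cot_deriv i (t\<^sup>2)"
proof -
  have *: "(let \<alpha> = alpha t; \<beta> = beta t in
     if i = 1 then - (1 / 2)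
     else if i = 2 then 1 / t^2 * (2 - (1 + 3 * \<alpha>) / (2 * \<beta>))
     else if i = 4 then 1 / t^4 * (1 - (1 + \<alpha>) / (2 * \<beta>))
     else 0) = ad_coeff inv_odd cot_deriv i (t\<^sup>2)" if t: "t \<noteq> 0" "beta t \<noteq> 0" for t
  proof -
    define s where "s = t\<^sup>2"
    define \<gamma> where "\<gamma> = gam t"
    have s: "s \<noteq> 0" "trig_tail 2 s \<noteq> 0" using t by (simp_all add: s_def beta_eq)
    have q: "(1 + k * alpha t) / (2 * beta t) = (\<gamma>\<^sup>2 + s / 4 + k * \<gamma>) / 2" for k
    proof -
      have "(1 + k * alpha t) / (2 * beta t) = (1 / beta t + k * (alpha t / beta t)) / 2"
        by (simp add: add_divide_distrib)
      then show ?thesis by (simp add: gam_identities(2,3)[OF t] \<gamma>_def s_def)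
    qed
    have q1: "(1 + alpha t) / (2 * beta t) = (\<gamma>\<^sup>2 + s / 4 + \<gamma>) / 2"
      using q[of 1] unfolding mult_1 .
    show ?thesis
      unfolding Let_def even_powers ad_coeff_def s_def[symmetric] cot_deriv_riccati_solved[OF s]
        gam_identities(1)[OF t, folded s_def \<gamma>_def] q q1
      using s(1) by (simp add: inv_odd_def field_simps power2_eq_square)
  qed
  show ?thesis
    unfolding coeff_b_def
    by (rule extend0_eqI[where g = "\<lambda>t. ad_coeff inv_odd cot_deriv i (t\<^sup>2)"])
      (use * assms beta_nonzero_near_0 trig_tail_rec[of 2 0] in
        \<open>auto intro!: isCont_square isCont_inv_coeffs elim!: eventually_mono\<close>)
qed

lemma coeff_b_bar_eq:
  assumes "beta t \<noteq> 0"
  shows "coeff_b_bar i t = ad_coeff_bar inv_odd cot_deriv i (t\<^sup>2)"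
proof -
  have *: "(let \<beta> = beta t; \<gamma> = gam t in
     if i = 2 then
       3 / (4 * t^2) + 1 / t^4 * (\<gamma> * (3 / 2 + 1 / \<beta> + 3 * \<gamma>) - 3 / (2 * \<beta>) - 4)
     else if i = 4 then
       1 / (4 * t^4) + 1 / t^6 * (1 / (2 * \<beta>) + 3 / 2 * \<gamma> + \<gamma> / \<beta> + \<gamma>^2 - 4)
     else 0) = ad_coeff_bar inv_odd cot_deriv i (t\<^sup>2)" if t: "t \<noteq> 0" "beta t \<noteq> 0" for t
  proof -
    define s where "s = t\<^sup>2"
    define \<gamma> where "\<gamma> = gam t"
    have s: "s \<noteq> 0" "trig_tail 2 s \<noteq> 0" using t by (simp_all add: s_def beta_eq)
    have q: "k / beta t = k * (\<gamma>\<^sup>2 + s / 4)" "k / (m * beta t) = k * (\<gamma>\<^sup>2 + s / 4) / m" for k m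
      using gam_identities(2)[OF t, folded \<gamma>_def s_def]
      by (metis divide_inverse mult_1, metis divide_inverse divide_divide_eq_left mult_1 times_divide_eq_left mult.commute)
    show ?thesis
      unfolding Let_def even_powers ad_coeff_bar_def s_def[symmetric] \<gamma>_def[symmetric] cot_deriv_riccati_solved[OF s]
        gam_identities(1)[OF t, folded s_def \<gamma>_def] q
      using s(1) by (simp add: inv_odd_def field_simps eval_nat_numeral)
  qed
  show ?thesis
    unfolding coeff_b_bar_def
    by (rule extend0_eqI[where g = "\<lambda>t. ad_coeff_bar inv_odd cot_deriv i (t\<^sup>2)"])
      (use * assms beta_nonzero_near_0 trig_tail_rec[of 2 0] in
        \<open>auto intro!: isCont_square isCont_inv_coeffs elim!: eventually_mono\<close>)
qed

lemma coeff_b_breve_eq: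
  assumes "beta t \<noteq> 0"
  shows "coeff_b_breve i t = ad_coeff_breve inv_odd cot_deriv i (t\<^sup>2)"
proof -
  have *: "(let \<beta> = beta t; \<gamma> = gam t in
     if i = 2 then
       1 / t^6 * (16 + 1 / \<beta>^2 + (8 / \<beta> - 9 / 2) * \<gamma> - (9 + 4 / \<beta>) * \<gamma>^2
                  - 12 * \<gamma>^3 + 9 / (2 * \<beta>))
       - 1 / t^4 * (9 / 4 + 3 * \<gamma> + 1 / (2 * \<beta>))
     else if i = 4 then
       1 / t^8 * (24 - 2 / \<beta> - (15 / 2 + 4 / \<beta>) * \<gamma> - (11 / 2 + 3 / \<beta>) * \<gamma>^2 - 2 * \<gamma>^3)
       - 1 / t^6 * (11 / 8 + 1 / (4 * \<beta>) + 1 / 2 * \<gamma>)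
     else 0) = ad_coeff_breve inv_odd cot_deriv i (t\<^sup>2)" if t: "t \<noteq> 0" "beta t \<noteq> 0" for t
  proof -
    define s where "s = t\<^sup>2"
    define \<gamma> where "\<gamma> = gam t"
    have s: "s \<noteq> 0" "trig_tail 2 s \<noteq> 0" using t by (simp_all add: s_def beta_eq)
    have q: "k / beta t = k * (\<gamma>\<^sup>2 + s / 4)" "k / (m * beta t) = k * (\<gamma>\<^sup>2 + s / 4) / m" for k m
      using gam_identities(2)[OF t, folded \<gamma>_def s_def]
      by (metis divide_inverse mult_1, metis divide_inverse divide_divide_eq_left mult_1 times_divide_eq_left mult.commute)
    have q2: "1 / (beta t)\<^sup>2 = (\<gamma>\<^sup>2 + s / 4)\<^sup>2"
      using q(1)[of 1] by (simp flip: power_one_over)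
    show ?thesis
      unfolding Let_def even_powers ad_coeff_breve_def s_def[symmetric] \<gamma>_def[symmetric] q2 cot_deriv_riccati_solved[OF s]
        gam_identities(1)[OF t, folded s_def \<gamma>_def] q
      using s(1) by (simp add: inv_odd_def field_simps eval_nat_numeral)
  qed
  show ?thesis
    unfolding coeff_b_breve_def
    by (rule extend0_eqI[where g = "\<lambda>t. ad_coeff_breve inv_odd cot_deriv i (t\<^sup>2)"])
      (use * assms beta_nonzero_near_0 trig_tail_rec[of 2 0] in
        \<open>auto intro!: isCont_square isCont_inv_coeffs elim!: eventually_mono\<close>)
qed

section \<open>The algebra of the adjoint matrices\<close>

lemma vec_fst_pair [simp]: "vec_fst (vec_pair x y) = x"
  and vec_snd_pair [simp]: "vec_snd (vec_pair x y) = y"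
  by (simp_all add: vec_fst_def vec_snd_def vec_pair_def)

lemma vec_pair_collapse [simp]: "vec_pair (vec_fst X) (vec_snd X) = X"
  by (auto simp: vec_fst_def vec_snd_def vec_pair_def vec_eq_iff split: sum.split)

lemma vec6_eq_iff: "X = Y \<longleftrightarrow> vec_fst X = vec_fst Y \<and> vec_snd X = vec_snd Y"
  by (metis vec_pair_collapse)

lemma vec_fst_linear [simp]:
  "vec_fst 0 = 0" "vec_fst (X + Y) = vec_fst X + vec_fst Y" "vec_fst (X - Y) = vec_fst X - vec_fst Y"
  "vec_fst (- X) = - vec_fst X" "vec_fst (c *\<^sub>R X) = c *\<^sub>R vec_fst X"
  by (simp_all add: vec_fst_def vec_eq_iff)

lemma vec_snd_linear [simp]:
  "vec_snd 0 = 0" "vec_snd (X + Y) = vec_snd X + vec_snd Y" "vec_snd (X - Y) = vec_snd X - vec_snd Y"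
  "vec_snd (- X) = - vec_snd X" "vec_snd (c *\<^sub>R X) = c *\<^sub>R vec_snd X"
  by (simp_all add: vec_snd_def vec_eq_iff)

lemma sum_UNIV_sum:
  "(\<Sum>i\<in>UNIV. f i) = (\<Sum>k\<in>UNIV. f (Inl k)) + (\<Sum>k\<in>UNIV. f (Inr k))"
  for f :: "'a::finite + 'b::finite \<Rightarrow> 'c::comm_monoid_add"
  unfolding UNIV_Plus_UNIV[symmetric] by (subst sum.Plus) (simp_all add: comp_def)

lemma inner_vec6: "X \<bullet> Y = vec_fst X \<bullet> vec_fst Y + vec_snd X \<bullet> vec_snd Y" for X Y :: vec6
  by (simp add: inner_vec_def sum_UNIV_sum vec_fst_def vec_snd_def)

lemma block_mult_vec:
  "block A B C D *v Y =
     vec_pair (A *v vec_fst Y + B *v vec_snd Y) (C *v vec_fst Y + D *v vec_snd Y)"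
  by (auto simp: vec_eq_iff block_def matrix_vector_mult_def sum_UNIV_sum vec_pair_def
      vec_fst_def vec_snd_def split: sum.split)

lemma skew_mult_vec [simp]: "skew x *v y = x \<times> y"
proof -
  have "linear (cross3 x)"
    using bilinear_cross by (simp add: bilinear_def)
  then show ?thesis unfolding skew_def by (metis matrix_vector_mul)
qed

lemma ad_mult_vec:
  "ad X *v Y = vec_pair (vec_fst X \<times> vec_fst Y) (vec_snd X \<times> vec_fst Y + vec_fst X \<times> vec_snd Y)"
  by (simp add: ad_def block_mult_vec)

lemma bounded_bilinear_ad: "bounded_bilinear (\<lambda>X Y. ad X *v Y)"
  unfolding bilinear_conv_bounded_bilinear[symmetric] bilinear_def ad_mult_vec
  by (auto intro!: linearI simp: vec6_eq_iff cross3_simps)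

interpretation ad: bounded_bilinear "\<lambda>X Y. ad X *v Y"
  by (rule bounded_bilinear_ad)

lemma ad_skew: "ad X *v Y = - (ad Y *v X)"
  by (simp add: ad_mult_vec vec6_eq_iff) (simp add: cross3_def vec_eq_iff forall_3)

lemma ad_jacobi: "ad (ad X *v Y) *v W = ad X *v (ad Y *v W) - ad Y *v (ad X *v W)"
  by (simp add: ad_mult_vec vec6_eq_iff) (simp add: cross3_def vec_eq_iff forall_3 algebra_simps)

text \<open>
  This is \<open>ad_bar U *v W = transpose (ad W) *v U\<close>, the defining property of \<open>ad_bar\<close>, in weak form.
\<close>

lemma inner_ad_bar: "V \<bullet> (ad_bar U *v W) = U \<bullet> (ad W *v V)"
  by (simp add: ad_bar_def block_mult_vec ad_mult_vec inner_vec6)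
    (simp add: cross3_def inner_vec_def sum_3 algebra_simps)

text \<open>
  Up to a term \<open>r\<close> that lies in the second component only, \<open>A\<^sup>3 = - s A\<close> holds as in \<open>so(3)\<close>;
  on \<open>r\<close>, whose second component is orthogonal to \<open>x\<close>, \<open>A\<^sup>2\<close> acts as \<open>- s\<close>.
\<close>

lemma ad_cayley_hamilton:
  fixes X W :: vec6
  defines "s \<equiv> vec_fst X \<bullet> vec_fst X" and "L \<equiv> \<lambda>W. ad X *v W"
  shows "L (L (L (L (L W)))) = - (2 * s) *\<^sub>R L (L (L W)) - s\<^sup>2 *\<^sub>R L W"
proof -
  define x y where "x = vec_fst X" and "y = vec_snd X"
  have s: "s = x \<bullet> x" by (simp add: s_def x_def)
  have L3: "L (L (L W)) = - s *\<^sub>R L W - (2 * (x \<bullet> y)) *\<^sub>R vec_pair 0 (x \<times> vec_fst W)" for W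
    unfolding L_def s ad_mult_vec x_def y_def
    by (simp add: vec6_eq_iff) (simp add: cross3_def vec_eq_iff forall_3 inner_vec_def sum_3 algebra_simps)
  have Lr: "L (L (vec_pair 0 (x \<times> w))) = - s *\<^sub>R vec_pair 0 (x \<times> w)" for w
    unfolding L_def s ad_mult_vec x_def y_def
    by (simp add: vec6_eq_iff) (simp add: cross3_def vec_eq_iff forall_3 inner_vec_def sum_3 algebra_simps)
  have lin: "L (L (a *\<^sub>R U - b *\<^sub>R V)) = a *\<^sub>R L (L U) - b *\<^sub>R L (L V)" for a b U V
    by (simp add: L_def ad.diff_right ad.scaleR_right)
  have combine: "- s *\<^sub>R U + s *\<^sub>R (- s *\<^sub>R V - U) = - (2 * s) *\<^sub>R U - s\<^sup>2 *\<^sub>R V" for U V :: vec6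
  proof -
    have "(2 * s) *\<^sub>R U = s *\<^sub>R U + s *\<^sub>R U"
      by (simp flip: scaleR_left_distrib)
    then show ?thesis by (simp add: scaleR_diff_right power2_eq_square)
  qed
  define r where "r = vec_pair 0 (x \<times> vec_fst W)"
  have 3: "L (L (L W)) = - s *\<^sub>R L W - (2 * (x \<bullet> y)) *\<^sub>R r" unfolding r_def by (rule L3)
  have "L (L (L (L (L W)))) = - s *\<^sub>R L (L (L W)) - (2 * (x \<bullet> y)) *\<^sub>R L (L r)"
    by (subst 3) (rule lin)
  also have "L (L r) = - s *\<^sub>R r" unfolding r_def by (rule Lr)
  also have "- s *\<^sub>R L (L (L W)) - (2 * (x \<bullet> y)) *\<^sub>R - s *\<^sub>R r
      = - s *\<^sub>R L (L (L W)) + s *\<^sub>R ((2 * (x \<bullet> y)) *\<^sub>R r)"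
    by (simp add: mult.commute)
  also have "(2 * (x \<bullet> y)) *\<^sub>R r = - s *\<^sub>R L W - L (L (L W))"
    using 3 by simp
  finally show ?thesis
    by (simp only: combine)
qed

lemma minus_mult_vec: "(- A) *v x = - (A *v x)" for A :: "real^'n^'m"
  using matrix_vector_mult_diff_rdistrib[of 0 A x] by simp

lemma matpow_0 [simp]: "matpow A 0 = mat 1"
  and matpow_Suc: "matpow A (Suc n) = A ** matpow A n"
  by (simp_all add: matpow_def)

text \<open>
  The first order Taylor expansion of \<open>z\<^sup>k\<close> at \<open>- s\<close>, evaluated at \<open>z = A\<^sup>2\<close>; the remainder
  contains \<open>(A\<^sup>2 + s)\<^sup>2\<close>, which vanishes next to a factor \<open>A\<close>.
\<close>

lemma matpow_ad_reduce:
  fixes X :: vec6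
  assumes "n \<ge> 1"
  defines "A \<equiv> ad X" and "s \<equiv> vec_fst X \<bullet> vec_fst X"
  shows "matpow A (2 * k + n) =
    ((- s) ^ k - real k * (- s) ^ k) *\<^sub>R matpow A n + (real k * (- s) ^ (k - 1)) *\<^sub>R matpow A (n + 2)"
proof -
  \<comment> \<open>Needs \<open>m \<ge> 1\<close>: the annihilating polynomial has the factor \<open>A\<close>.\<close>
  have step: "matpow A (m + 4) = - (2 * s) *\<^sub>R matpow A (m + 2) - s\<^sup>2 *\<^sub>R matpow A m" if "m \<ge> 1" for m
  proof -
    from that obtain l where l: "m = Suc l" by (cases m) auto
    have "matpow A (m + 4) *v W = (- (2 * s) *\<^sub>R matpow A (m + 2) - s\<^sup>2 *\<^sub>R matpow A m) *v W" for W
      using ad_cayley_hamilton[of X "matpow A l *v W"]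
      unfolding l A_def s_def
      by (simp add: numeral_eq_Suc matpow_Suc matrix_vector_mult_diff_rdistrib minus_mult_vec scaleR_matrix_vector_assoc[symmetric]
          matrix_vector_mul_assoc[symmetric] del: ad.minus_left)
    then show ?thesis by (simp add: matrix_eq)
  qed
  have combine: "x *\<^sub>R (a *\<^sub>R U + b *\<^sub>R V) - y *\<^sub>R (c *\<^sub>R U + d *\<^sub>R V)
      = (x * a - y * c) *\<^sub>R U + (x * b - y * d) *\<^sub>R V" for x y a b c d and U V :: mat6
    by (simp add: scaleR_right_distrib scaleR_left_diff_distrib)
  show ?thesis
  proof (induction k rule: less_induct)
    case (less k)
    consider "k = 0" | "k = 1" | l where "k = Suc (Suc l)" by (metis One_nat_def old.nat.exhaust)
    then show ?case
    proof cases
      case 3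
      have lt: "l < k" "Suc l < k" using 3 by auto
      have e: "2 * k + n = (2 * l + n) + 4" "2 * Suc l + n = (2 * l + n) + 2" using 3 by auto
      have "matpow A (2 * k + n) = - (2 * s) *\<^sub>R matpow A (2 * Suc l + n) - s\<^sup>2 *\<^sub>R matpow A (2 * l + n)"
        unfolding e using assms by (intro step) auto
      also have "\<dots> = ((- s) ^ k - real k * (- s) ^ k) *\<^sub>R matpow A n + (real k * (- s) ^ (k - 1)) *\<^sub>R matpow A (n + 2)"
        unfolding less.IH[OF lt(1)] less.IH[OF lt(2)] combine 3
        by (rule arg_cong2[where f = "\<lambda>a b. a *\<^sub>R matpow A n + b *\<^sub>R matpow A (n + 2)"])
          (cases l; simp add: algebra_simps power2_eq_square)+
      finally show ?thesis .
    qed auto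
  qed
qed

section \<open>Polynomial forms of dexp and its inverse\<close>

lemma sums_even_odd:
  fixes g :: "nat \<Rightarrow> 'a::real_normed_vector"
  assumes e: "(\<lambda>k. g (2 * k)) sums a" and o: "(\<lambda>k. g (2 * k + 1)) sums b"
  shows "g sums (a + b)"
proof -
  have "(\<lambda>i. if even i then g i else 0) sums a"
    by (subst sums_mono_reindex[of "\<lambda>k. 2 * k", symmetric])
      (use e in \<open>auto simp: strict_mono_def elim!: evenE\<close>)
  moreover have "(\<lambda>i. if odd i then g i else 0) sums b"
    by (subst sums_mono_reindex[of "\<lambda>k. 2 * k + 1", symmetric])
      (use o in \<open>auto simp: strict_mono_def elim!: oddE\<close>)
  ultimately have "(\<lambda>i. (if even i then g i else 0) + (if odd i then g i else 0)) sums (a + b)"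
    by (rule sums_add)
  then show ?thesis by (rule back_subst[where P = "\<lambda>f. f sums (a + b)"]) auto
qed

definition ad_poly :: "(nat \<Rightarrow> real \<Rightarrow> real) \<Rightarrow> vec6 \<Rightarrow> mat6" where
  "ad_poly c X = mat 1 + (\<Sum>i=1..4. c i (vec_fst X \<bullet> vec_fst X) *\<^sub>R matpow (ad X) i)"

text \<open>
  For \<open>n = 1\<close> and \<open>n = 2\<close> these are the terms of \<open>dexp\<close> of odd and of positive even degree.
\<close>

lemma matpow_ad_series:
  fixes X :: vec6
  assumes "n \<ge> 1"
  defines "s \<equiv> vec_fst X \<bullet> vec_fst X"
  shows "(\<lambda>k. (1 / fact (2 * k + (n + 1))) *\<^sub>R matpow (ad X) (2 * k + n)) sums
    ((trig_tail (n + 1) s - s * trig_tail_deriv 1 (n + 1) s) *\<^sub>R matpow (ad X) n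
      + (- trig_tail_deriv 1 (n + 1) s) *\<^sub>R matpow (ad X) (n + 2))"
proof -
  let ?w = "\<lambda>k. real k * (- s) ^ (k - 1) / fact (2 * k + (n + 1))"
  have t: "(1 / fact (2 * k + (n + 1))) *\<^sub>R matpow (ad X) (2 * k + n) =
      ((- s) ^ k / fact (2 * k + (n + 1)) + s * ?w k) *\<^sub>R matpow (ad X) n + ?w k *\<^sub>R matpow (ad X) (n + 2)" for k
    unfolding matpow_ad_reduce[OF assms(1), of X k] s_def[symmetric] scaleR_right_distrib scaleR_scaleR
    by (rule arg_cong2[where f = "\<lambda>a b. a *\<^sub>R matpow (ad X) n + b *\<^sub>R matpow (ad X) (n + 2)"])
      (cases k; simp add: add_divide_distrib diff_divide_distrib)+
  have w: "?w sums - trig_tail_deriv 1 (n + 1) s"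
    by (rule trig_tail_weighted_sums)
  have "(\<lambda>k. (- s) ^ k / fact (2 * k + (n + 1)) + s * ?w k) sums
      (trig_tail (n + 1) s + s * (- trig_tail_deriv 1 (n + 1) s))"
    by (intro sums_add sums_mult trig_tail_sums w)
  then have u: "(\<lambda>k. (- s) ^ k / fact (2 * k + (n + 1)) + s * ?w k) sums
      (trig_tail (n + 1) s - s * trig_tail_deriv 1 (n + 1) s)"
    by simp
  show ?thesis
    unfolding t by (intro sums_add sums_scaleR_left w u)
qed

lemma dexp_eq_ad_poly: "dexp X = ad_poly (ad_coeff dexp_odd dexp_even) X"
proof -
  let ?f = "\<lambda>i. (1 / fact (i + 1)) *\<^sub>R matpow (ad X) i"
  let ?s = "vec_fst X \<bullet> vec_fst X"
  note S = matpow_ad_series[of 1 X] matpow_ad_series[of 2 X]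
  have "(\<lambda>i. ?f (i + 1)) sums
     (((trig_tail 2 ?s - ?s * trig_tail_deriv 1 2 ?s) *\<^sub>R matpow (ad X) 1
      + (- trig_tail_deriv 1 2 ?s) *\<^sub>R matpow (ad X) 3) +
     ((trig_tail 3 ?s - ?s * trig_tail_deriv 1 3 ?s) *\<^sub>R matpow (ad X) 2
      + (- trig_tail_deriv 1 3 ?s) *\<^sub>R matpow (ad X) 4))" (is "_ sums ?S")
    by (rule sums_even_odd)
      (use S in \<open>simp_all add: eval_nat_numeral del: trig_tail_deriv.simps fact_Suc\<close>)
  then have "?f sums (?S + ?f 0)"
    using sums_Suc_iff[of ?f] by simp
  then have "dexp X = ?S + ?f 0"
    unfolding dexp_def by (rule sums_unique[symmetric])
  moreover have "{1..4} = {1, 2, 3, 4::nat}" by auto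
  ultimately show ?thesis
    by (simp add: ad_poly_def ad_coeff_def add_ac del: trig_tail_deriv.simps(2))
qed

lemma matrix_add_rdistrib: "(A + B) ** C = A ** C + B ** C" for A B :: "'a::semiring_1^'n^'m"
  by (simp add: vec_eq_iff matrix_matrix_mult_def distrib_right sum.distrib)

lemma matrix_mult_scaleR:
  fixes A :: "real^'n^'m" and B :: "real^'k^'n"
  shows "(c *\<^sub>R A) ** B = c *\<^sub>R (A ** B)" "A ** (c *\<^sub>R B) = c *\<^sub>R (A ** B)"
  by (simp_all add: vec_eq_iff matrix_matrix_mult_def sum_distrib_left mult_ac)

lemma matpow_add: "matpow A m ** matpow A n = matpow A (m + n)"
  by (induction m) (simp_all add: matpow_Suc flip: matrix_mul_assoc)

text \<open>
  The collection of terms in the product of the two polynomials, where \<open>U\<^sub>i\<close> stands for \<open>A\<^sup>i\<close> and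
  the powers 5 to 8 are reduced by \<open>matpow_ad_reduce\<close>. Vectors replace matrices so that
  simplification does not see the componentwise multiplication of type \<open>vec\<close>.
\<close>

lemma combination_eq_zero:
  fixes U1 U2 U3 U4 :: "'a::real_vector"
  assumes "c1 - s\<^sup>2 * c5 + 2 * s ^ 3 * c7 = 0" "c2 - s\<^sup>2 * c6 + 2 * s ^ 3 * c8 = 0"
    "c3 - 2 * s * c5 + 3 * s\<^sup>2 * c7 = 0" "c4 - 2 * s * c6 + 3 * s\<^sup>2 * c8 = 0"
  shows "c1 *\<^sub>R U1 + c2 *\<^sub>R U2 + c3 *\<^sub>R U3 + c4 *\<^sub>R U4
    + c5 *\<^sub>R ((- s\<^sup>2) *\<^sub>R U1 + (- 2 * s) *\<^sub>R U3) + c6 *\<^sub>R ((- s\<^sup>2) *\<^sub>R U2 + (- 2 * s) *\<^sub>R U4)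
    + c7 *\<^sub>R ((2 * s ^ 3) *\<^sub>R U1 + (3 * s\<^sup>2) *\<^sub>R U3)
    + c8 *\<^sub>R ((2 * s ^ 3) *\<^sub>R U2 + (3 * s\<^sup>2) *\<^sub>R U4) = 0" (is "?L = 0")
proof -
  have "?L = (c1 - s\<^sup>2 * c5 + 2 * s ^ 3 * c7) *\<^sub>R U1 + (c2 - s\<^sup>2 * c6 + 2 * s ^ 3 * c8) *\<^sub>R U2
    + (c3 - 2 * s * c5 + 3 * s\<^sup>2 * c7) *\<^sub>R U3 + (c4 - 2 * s * c6 + 3 * s\<^sup>2 * c8) *\<^sub>R U4"
    by (simp add: algebra_simps)
  then show ?thesis by (simp add: assms)
qed

text \<open>
  The sums for odd powers are combinations of the odd identity and its derivative, those for
  even powers of the even identity and its derivative.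
\<close>

lemma inverse_coefficients:
  fixes s :: real
  assumes s: "trig_tail 2 s \<noteq> 0"
  defines "a \<equiv> \<lambda>i. ad_coeff dexp_odd dexp_even i s" and "b \<equiv> \<lambda>i. ad_coeff inv_odd cot_deriv i s"
  shows "(a 1 + b 1) - s\<^sup>2 * (a 4 * b 1 + a 3 * b 2 + a 1 * b 4) + 2 * s ^ 3 * (a 3 * b 4) = 0"
    "(a 2 + a 1 * b 1 + b 2) - s\<^sup>2 * (a 4 * b 2 + a 2 * b 4) + 2 * s ^ 3 * (a 4 * b 4) = 0"
    "(a 3 + a 2 * b 1 + a 1 * b 2) - 2 * s * (a 4 * b 1 + a 3 * b 2 + a 1 * b 4) + 3 * s\<^sup>2 * (a 3 * b 4) = 0"
    "(a 4 + a 3 * b 1 + a 2 * b 2 + b 4) - 2 * s * (a 4 * b 2 + a 2 * b 4) + 3 * s\<^sup>2 * (a 4 * b 4) = 0"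
proof -
  define F F' G G' B B' where "F = trig_tail 2 s" and "F' = trig_tail_deriv 1 2 s"
    and "G = trig_tail 3 s" and "G' = trig_tail_deriv 1 3 s"
    and "B = cot_deriv 0 s" and "B' = cot_deriv 1 s"
  have v: "a 1 = F - s * F'" "a 2 = G - s * G'" "a 3 = - F'" "a 4 = - G'"
    "b 1 = - (1 / 2)" "b 2 = B - s * B'" "b 4 = - B'"
    by (simp_all add: a_def b_def ad_coeff_def inv_odd_def F_def F'_def G_def G'_def B_def B'_def
        del: trig_tail_deriv.simps(2))
  note I = inverse_odd_identity[OF s, folded F_def G_def B_def]
    inverse_odd_identity'[OF s, folded F_def F'_def G_def G'_def B_def B'_def]
    inverse_even_identity[OF s, folded F_def G_def B_def]
    inverse_even_identity'[OF s, folded F_def F'_def G_def G'_def B_def B'_def]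
  show "(a 1 + b 1) - s\<^sup>2 * (a 4 * b 1 + a 3 * b 2 + a 1 * b 4) + 2 * s ^ 3 * (a 3 * b 4) = 0"
  proof -
    have "(a 1 + b 1) - s\<^sup>2 * (a 4 * b 1 + a 3 * b 2 + a 1 * b 4) + 2 * s ^ 3 * (a 3 * b 4) =
      (F - 1 / 2 - s * (F * B) + s * G / 2)
      - s * (F' - F * B - s * (F' * B + F * B') + G / 2 + s * G' / 2)"
      unfolding v by (simp add: field_simps power2_eq_square power3_eq_cube)
    then show ?thesis unfolding I(1,2) by simp
  qed
  show "(a 2 + a 1 * b 1 + b 2) - s\<^sup>2 * (a 4 * b 2 + a 2 * b 4) + 2 * s ^ 3 * (a 4 * b 4) = 0"
    unfolding v using I(3,4) by algebra
  show "(a 3 + a 2 * b 1 + a 1 * b 2) - 2 * s * (a 4 * b 1 + a 3 * b 2 + a 1 * b 4) + 3 * s\<^sup>2 * (a 3 * b 4) = 0"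
  proof -
    have "(a 3 + a 2 * b 1 + a 1 * b 2) - 2 * s * (a 4 * b 1 + a 3 * b 2 + a 1 * b 4) + 3 * s\<^sup>2 * (a 3 * b 4) =
      - (F' - F * B - s * (F' * B + F * B') + G / 2 + s * G' / 2)"
      unfolding v by (simp add: field_simps power2_eq_square)
    then show ?thesis unfolding I(2) by simp
  qed
  show "(a 4 + a 3 * b 1 + a 2 * b 2 + b 4) - 2 * s * (a 4 * b 2 + a 2 * b 4) + 3 * s\<^sup>2 * (a 4 * b 4) = 0"
    unfolding v using I(3,4) by algebra
qed

lemma ad_poly_inverse:
  fixes X :: vec6
  assumes "trig_tail 2 (vec_fst X \<bullet> vec_fst X) \<noteq> 0"
  shows "ad_poly (ad_coeff dexp_odd dexp_even) X ** ad_poly (ad_coeff inv_odd cot_deriv) X = mat 1"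
proof -
  define s where "s = vec_fst X \<bullet> vec_fst X"
  define a b where "a i = ad_coeff dexp_odd dexp_even i s" and "b i = ad_coeff inv_odd cot_deriv i s" for i
  define M where "M = matpow (ad X)"
  have b3: "b 3 = 0" by (simp add: b_def ad_coeff_def inv_odd_def)
  have four: "{1..4} = {1, 2, 3, 4::nat}" by auto
  have prod: "M m ** M n = M (m + n)" for m n by (simp add: M_def matpow_add)
  have red: "M 5 = (- s\<^sup>2) *\<^sub>R M 1 + (- 2 * s) *\<^sub>R M 3" "M 6 = (- s\<^sup>2) *\<^sub>R M 2 + (- 2 * s) *\<^sub>R M 4"
    "M 7 = (2 * s ^ 3) *\<^sub>R M 1 + (3 * s\<^sup>2) *\<^sub>R M 3" "M 8 = (2 * s ^ 3) *\<^sub>R M 2 + (3 * s\<^sup>2) *\<^sub>R M 4"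
    using matpow_ad_reduce[of 1 X 2] matpow_ad_reduce[of 2 X 2] matpow_ad_reduce[of 1 X 3] matpow_ad_reduce[of 2 X 3]
    unfolding M_def s_def[symmetric] by (simp_all add: eval_nat_numeral mult.assoc)
  have "ad_poly (ad_coeff dexp_odd dexp_even) X ** ad_poly (ad_coeff inv_odd cot_deriv) X
    = (mat 1 + (a 1 *\<^sub>R M 1 + a 2 *\<^sub>R M 2 + a 3 *\<^sub>R M 3 + a 4 *\<^sub>R M 4))
      ** (mat 1 + (b 1 *\<^sub>R M 1 + b 2 *\<^sub>R M 2 + b 4 *\<^sub>R M 4))"
    unfolding ad_poly_def s_def[symmetric] a_def[symmetric] b_def[symmetric] M_def[symmetric] four
    by (simp add: b3 add_ac)
  also have "\<dots> = mat 1 +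
     ((a 1 + b 1) *\<^sub>R M 1 + (a 2 + a 1 * b 1 + b 2) *\<^sub>R M 2 + (a 3 + a 2 * b 1 + a 1 * b 2) *\<^sub>R M 3
      + (a 4 + a 3 * b 1 + a 2 * b 2 + b 4) *\<^sub>R M 4
      + (a 4 * b 1 + a 3 * b 2 + a 1 * b 4) *\<^sub>R M 5 + (a 4 * b 2 + a 2 * b 4) *\<^sub>R M 6
      + (a 3 * b 4) *\<^sub>R M 7 + (a 4 * b 4) *\<^sub>R M 8)"
    by (simp add: matrix_add_ldistrib matrix_add_rdistrib matrix_mult_scaleR prod scaleR_left_distrib
        scaleR_right_distrib eval_nat_numeral ac_simps)
  also have "\<dots> = mat 1"
    unfolding red
    using combination_eq_zero[OF inverse_coefficients[OF assms, folded s_def, folded a_def b_def],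
        of "M 1" "M 2" "M 3" "M 4"]
    by simp
  finally show ?thesis .
qed

lemma matrix_inv_eqI:
  fixes A B :: "'a::field^'n^'n"
  assumes "A ** B = mat 1"
  shows "matrix_inv A = B"
proof -
  have BA: "B ** A = mat 1" using assms by (simp add: matrix_left_right_inverse)
  have "A ** matrix_inv A = mat 1 \<and> matrix_inv A ** A = mat 1"
    unfolding matrix_inv_def by (rule someI[of _ B]) (simp add: assms BA)
  then have "B ** (A ** matrix_inv A) = B" by simp
  then show ?thesis by (simp add: matrix_mul_assoc BA)
qed

lemma dexp_inv_eq_ad_poly:
  assumes "trig_tail 2 (vec_fst X \<bullet> vec_fst X) \<noteq> 0"
  shows "dexp_inv X = ad_poly (ad_coeff inv_odd cot_deriv) X"
  unfolding dexp_inv_def dexp_eq_ad_poly by (rule matrix_inv_eqI[OF ad_poly_inverse[OF assms]])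

section \<open>The Hessian of a polynomial in ad X\<close>

text \<open>
  The directional derivative of \<open>A\<^sup>i Z\<close>: the sum over all ways of replacing one factor \<open>ad X\<close> by
  \<open>ad V\<close>.
\<close>

primrec Z_it_deriv :: "vec6 \<Rightarrow> vec6 \<Rightarrow> nat \<Rightarrow> vec6 \<Rightarrow> vec6" where
  "Z_it_deriv X Z 0 V = 0"
| "Z_it_deriv X Z (Suc i) V = ad V *v Z_it X Z i + ad X *v Z_it_deriv X Z i V"

text \<open>
  The second derivative: one factor \<open>ad X\<close> is replaced by \<open>ad V\<close> and another one by \<open>ad W\<close>.
\<close>

primrec Z_it_deriv2 :: "vec6 \<Rightarrow> vec6 \<Rightarrow> nat \<Rightarrow> vec6 \<Rightarrow> vec6 \<Rightarrow> vec6" where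
  "Z_it_deriv2 X Z 0 V W = 0"
| "Z_it_deriv2 X Z (Suc i) V W =
     ad V *v Z_it_deriv X Z i W + ad W *v Z_it_deriv X Z i V + ad X *v Z_it_deriv2 X Z i V W"

lemma Z_it_0 [simp]: "Z_it X Z 0 = Z"
  and Z_it_Suc: "Z_it X Z (Suc i) = ad X *v Z_it X Z i"
  by (simp_all add: Z_it_def matpow_Suc flip: matrix_vector_mul_assoc)

lemma line_has_vector_derivative: "((\<lambda>t. X + t *\<^sub>R V) has_vector_derivative V) (at t)"
  by (auto intro!: derivative_eq_intros)

lemma Z_it_has_vector_derivative:
  "((\<lambda>t. Z_it (X + t *\<^sub>R V) Z i) has_vector_derivative Z_it_deriv X Z i V) (at 0)"
proof (induction i)
  case (Suc i)
  show ?case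
    using ad.has_vector_derivative[OF line_has_vector_derivative[of X V] Suc]
    by (simp add: Z_it_Suc add.commute)
qed simp

lemma Z_it_deriv_has_vector_derivative:
  "((\<lambda>t. Z_it_deriv (X + t *\<^sub>R W) Z i V) has_vector_derivative Z_it_deriv2 X Z i V W) (at 0)"
proof (induction i)
  case (Suc i)
  have "((\<lambda>t. ad V *v Z_it (X + t *\<^sub>R W) Z i) has_vector_derivative ad V *v Z_it_deriv X Z i W) (at 0)"
    by (rule bounded_linear.has_vector_derivative[OF ad.bounded_linear_right Z_it_has_vector_derivative])
  from has_vector_derivative_add[OF this ad.has_vector_derivative[OF line_has_vector_derivative[of X W] Suc]]
  show ?case by (simp add: ac_simps)
qed simp

lemma inner_has_real_derivative:
  assumes "(f has_vector_derivative f') (at t)"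
  shows "((\<lambda>t. Q \<bullet> f t) has_real_derivative Q \<bullet> f') (at t)"
  using bounded_linear.has_vector_derivative[OF bounded_linear_inner_right assms]
  by (simp add: has_real_derivative_iff_has_vector_derivative)

lemma norm_sq_has_real_derivative:
  "((\<lambda>t. vec_fst (X + t *\<^sub>R V) \<bullet> vec_fst (X + t *\<^sub>R V)) has_real_derivative 2 * (vec_fst X \<bullet> vec_fst V)) (at 0)"
  by (auto intro!: derivative_eq_intros simp: inner_simps inner_commute)

text \<open>
  The factor 2 in the derivative of \<open>x \<bullet> x\<close> cancels the \<open>1 / 2\<close> that relates the plain
  coefficients to the barred ones.
\<close>

lemma coeff_has_real_derivative:
  assumes "(c has_real_derivative d / 2) (at (vec_fst X \<bullet> vec_fst X))"
  shows "((\<lambda>t. c (vec_fst (X + t *\<^sub>R V) \<bullet> vec_fst (X + t *\<^sub>R V)))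
    has_real_derivative d * (vec_fst X \<bullet> vec_fst V)) (at 0)"
proof -
  have "(c has_real_derivative d / 2) (at (vec_fst (X + 0 *\<^sub>R V) \<bullet> vec_fst (X + 0 *\<^sub>R V)))"
    using assms by simp
  from DERIV_chain2[OF this norm_sq_has_real_derivative] show ?thesis by simp
qed

lemma bounded_linear_vec_fst: "bounded_linear vec_fst"
  unfolding linear_conv_bounded_linear[symmetric] by (rule linearI) simp_all

lemma open_norm_sq_preimage:
  assumes "open U" shows "open {Y. vec_fst Y \<bullet> vec_fst Y \<in> U}"
proof -
  have "continuous_on UNIV (\<lambda>Y. vec_fst Y \<bullet> vec_fst Y)"
    by (intro continuous_intros linear_continuous_on bounded_linear_vec_fst)
  from open_vimage[OF assms this] show ?thesis by (simp add: vimage_def)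
qed

lemma matrix_entry: "H $ i $ j = axis i 1 \<bullet> (H *v axis j 1)" for H :: "real^'n^'m"
  by (simp add: matrix_vector_mult_basis column_def inner_axis')

lemma inner_transpose: "V \<bullet> (transpose M *v W) = W \<bullet> (M *v V)" for M :: "real^'n^'m"
  by (metis dot_lmul_matrix inner_commute transpose_matrix_vector)

lemma outer_mult_vec: "outer u v *v w = (v \<bullet> w) *\<^sub>R u"
  by (simp add: vec_eq_iff outer_def matrix_matrix_mult_def matrix_vector_mult_def columnvector_def
      rowvector_def inner_vec_def sum_distrib_left mult_ac)

lemma inner_ad_bar_flip: "V \<bullet> (ad_bar U *v W) = - (U \<bullet> (ad V *v W))"
  using inner_ad_bar ad_skew[of V W] by (simp add: inner_ad_bar)

lemma inner_Q_it: "Q_it X Q i \<bullet> Y = Q \<bullet> (matpow (ad X) i *v Y)"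
  unfolding Q_it_def by (metis inner_commute inner_transpose)

lemmas mat_expand = matrix_vector_mult_add_rdistrib matrix_vector_mult_diff_rdistrib minus_mult_vec
  matrix_vector_mul_assoc[symmetric] scaleR_matrix_vector_assoc[symmetric]

lemma H1_form:
  "V \<bullet> (H1_term c_bar c_breve Q Z X i *v W) = (Q \<bullet> Z_it X Z i) *
     (c_bar i (norm (vec_fst X)) * (vec_fst V \<bullet> vec_fst W)
      + c_breve i (norm (vec_fst X)) * ((vec_fst X \<bullet> vec_fst V) * (vec_fst X \<bullet> vec_fst W)))"
  by (simp add: H1_term_def Let_def block_mult_vec inner_vec6 mat_expand outer_mult_vec inner_simps
      inner_commute)

text \<open>
  \<open>H2_term\<close> alone collects the terms in which \<open>ad V\<close> stands to the left of \<open>ad W\<close>; its transpose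
  supplies the other order.
\<close>

lemma H2_form:
  assumes "i \<in> {2, 3, 4}"
  shows "V \<bullet> ((H2_term c Q Z X i + transpose (H2_term c Q Z X i)) *v W) =
    c i (norm (vec_fst X)) * (Q \<bullet> Z_it_deriv2 X Z i V W)"
proof -
  have sk: "ad Z *v Y = - (ad Y *v Z)" "ad (ad X *v Y) *v V = - (ad V *v (ad X *v Y))"
    "ad (ad X *v Y) *v W = - (ad W *v (ad X *v Y))" for Y
    by (rule ad_skew)+
  have "V \<bullet> (H2_term c Q Z X i *v W) + W \<bullet> (H2_term c Q Z X i *v V) =
    c i (norm (vec_fst X)) * (Q \<bullet> Z_it_deriv2 X Z i V W)"
    using assms unfolding H2_term_def Let_def
    by (auto simp: mat_expand inner_ad_bar_flip inner_Q_it sk inner_simps ad.minus_right ad.add_right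
        eval_nat_numeral matpow_Suc Z_it_Suc algebra_simps simp del: transpose_matrix_vector)
  then show ?thesis by (simp add: mat_expand inner_transpose inner_add_right del: transpose_matrix_vector)
qed

text \<open>
  Antisymmetry turns each \<open>ad (A\<^sup>k Z) *v W\<close> into \<open>- ad W *v A\<^sup>k Z\<close>. For \<open>i = 2\<close> the term is written
  with \<open>ad Z ** ad X\<close>, and the Jacobi identity is needed.
\<close>

lemma H3_half_form:
  assumes "i \<in> {1, 2, 3, 4}"
  shows "V \<bullet> (H3_term c_bar Q Z X i *v W) =
    c_bar i (norm (vec_fst X)) * ((vec_fst X \<bullet> vec_fst V) * (Q \<bullet> Z_it_deriv X Z i W))"
proof -
  have sk: "ad Z *v Y = - (ad Y *v Z)" "ad (ad X *v Y) *v V = - (ad V *v (ad X *v Y))"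
    "ad (ad X *v Y) *v W = - (ad W *v (ad X *v Y))" for Y
    by (rule ad_skew)+
  have P: "V \<bullet> (outer (vec_pair (vec_fst X) 0) Q *v Y) = (vec_fst X \<bullet> vec_fst V) * (Q \<bullet> Y)" for Y
    by (simp add: outer_mult_vec inner_vec6 inner_commute)
  \<comment> \<open>This turns \<open>ad Z ** ad X - 2 ad X ** ad Z\<close> into the two terms of the derivative of \<open>A\<^sup>2 Z\<close>.\<close>
  have J: "ad Z *v (ad X *v W) = ad W *v (ad X *v Z) - ad X *v (ad W *v Z)"
    using ad_jacobi[of X W Z] ad_skew[of Z "ad X *v W"] by simp
  show ?thesis
    using assms unfolding H3_term_def Let_def
    by (auto simp: mat_expand P J) (auto simp: sk inner_simps ad.minus_right ad.add_right
        eval_nat_numeral matpow_Suc Z_it_Suc mat_expand algebra_simps simp del: transpose_matrix_vector)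
qed

lemma H3_form:
  assumes "i \<in> {1, 2, 3, 4}"
  shows "V \<bullet> ((H3_term c_bar Q Z X i + transpose (H3_term c_bar Q Z X i)) *v W) =
    c_bar i (norm (vec_fst X)) * ((vec_fst X \<bullet> vec_fst V) * (Q \<bullet> Z_it_deriv X Z i W)
      + (vec_fst X \<bullet> vec_fst W) * (Q \<bullet> Z_it_deriv X Z i V))"
  by (simp add: mat_expand inner_transpose inner_add_right H3_half_form[OF assms] distrib_left
      del: transpose_matrix_vector)

lemma Z_it_deriv2_commute: "Z_it_deriv2 X Z i V W = Z_it_deriv2 X Z i W V"
  by (induction i) (simp_all add: ac_simps)

lemma sum_mult_vec: "(\<Sum>i\<in>I. f i) *v v = (\<Sum>i\<in>I. f i *v v)" for f :: "'i \<Rightarrow> real^'n^'m"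
  by (induction I rule: infinite_finite_induct) (auto simp: matrix_vector_mult_add_rdistrib)

text \<open>
  The set \<open>U\<close> of admissible \<open>s\<close> is open, so that the first partial derivatives exist near \<open>X\<close>. The
  functions \<open>k\<close>, of the argument \<open>\<phi>\<close>, only have to agree with the functions \<open>c\<close> of \<open>s\<close> at \<open>X\<close> itself.
\<close>

lemma has_hessian_ad_poly:
  fixes Q Z X :: vec6 and c c_bar c_breve :: "nat \<Rightarrow> real \<Rightarrow> real"
  defines "\<phi> \<equiv> norm (vec_fst X)"
  assumes U: "open U" "vec_fst X \<bullet> vec_fst X \<in> U"
    and c: "\<And>i s. s \<in> U \<Longrightarrow> (c i has_real_derivative c_bar i s / 2) (at s)"
    and c_bar: "\<And>i s. s \<in> U \<Longrightarrow> (c_bar i has_real_derivative c_breve i s / 2) (at s)"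
    and M: "\<And>Y. vec_fst Y \<bullet> vec_fst Y \<in> U \<Longrightarrow> M Y = ad_poly c Y"
    and k: "\<And>i. k i \<phi> = c i (\<phi>\<^sup>2)" "\<And>i. k_bar i \<phi> = c_bar i (\<phi>\<^sup>2)" "\<And>i. k_breve i \<phi> = c_breve i (\<phi>\<^sup>2)"
  shows "has_hessian (\<lambda>Y. Q \<bullet> (M Y *v Z))
    ((\<Sum>i=1..4. H1_term k_bar k_breve Q Z X i)
     + (\<Sum>i=2..4. H2_term k Q Z X i + transpose (H2_term k Q Z X i))
     + (\<Sum>i=1..4. H3_term k_bar Q Z X i + transpose (H3_term k_bar Q Z X i))) X"
    (is "has_hessian _ ?H X")
proof -
  let ?s = "\<lambda>Y. vec_fst Y \<bullet> vec_fst Y"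
  define D where "D Y V = (\<Sum>i=1..4. c_bar i (?s Y) * (vec_fst Y \<bullet> vec_fst V) * (Q \<bullet> Z_it Y Z i)
      + c i (?s Y) * (Q \<bullet> Z_it_deriv Y Z i V))" for Y V
  define D2 where "D2 V W = (\<Sum>i=1..4.
      (c_breve i (?s X) * (vec_fst X \<bullet> vec_fst W) * (vec_fst X \<bullet> vec_fst V)
        + c_bar i (?s X) * (vec_fst W \<bullet> vec_fst V)) * (Q \<bullet> Z_it X Z i)
      + c_bar i (?s X) * (vec_fst X \<bullet> vec_fst V) * (Q \<bullet> Z_it_deriv X Z i W)
      + c_bar i (?s X) * (vec_fst X \<bullet> vec_fst W) * (Q \<bullet> Z_it_deriv X Z i V)
      + c i (?s X) * (Q \<bullet> Z_it_deriv2 X Z i V W))" for V W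
  have h: "Q \<bullet> (M Y *v Z) = Q \<bullet> Z + (\<Sum>i=1..4. c i (?s Y) * (Q \<bullet> Z_it Y Z i))" if "?s Y \<in> U" for Y
  proof -
    have "{1..4} = {1, 2, 3, 4::nat}" by auto
    then show ?thesis
      by (simp add: M[OF that] ad_poly_def mat_expand inner_simps Z_it_def)
  qed
  have d1: "((\<lambda>t. Q \<bullet> (M (Y + t *\<^sub>R V) *v Z)) has_real_derivative D Y V) (at 0)" if Y: "?s Y \<in> U" for Y V
  proof -
    have "((\<lambda>t. Q \<bullet> Z + (\<Sum>i=1..4. c i (?s (Y + t *\<^sub>R V)) * (Q \<bullet> Z_it (Y + t *\<^sub>R V) Z i)))
        has_real_derivative D Y V) (at 0)"
      unfolding D_def
      by (rule derivative_eq_intros refl coeff_has_real_derivative[OF c[OF Y]]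
          inner_has_real_derivative[OF Z_it_has_vector_derivative])+ (simp add: mult_ac)
    moreover have "open ((\<lambda>t. Y + t *\<^sub>R V) -` {Y. ?s Y \<in> U})"
      by (intro open_vimage open_norm_sq_preimage U continuous_intros)
    ultimately show ?thesis
      by (rule has_field_derivative_transform_within_open) (use Y h in auto)
  qed
  have d2: "((\<lambda>t. D (X + t *\<^sub>R W) V) has_real_derivative D2 V W) (at 0)" for V W
  proof -
    have l: "((\<lambda>t. vec_fst (X + t *\<^sub>R W) \<bullet> vec_fst V) has_real_derivative vec_fst W \<bullet> vec_fst V) (at 0)"
      by (auto intro!: derivative_eq_intros simp: inner_simps)
    show ?thesis
      unfolding D_def D2_def
      by (rule derivative_eq_intros refl l coeff_has_real_derivative[OF c[OF U(2)]]
          coeff_has_real_derivative[OF c_bar[OF U(2)]]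
          inner_has_real_derivative[OF Z_it_has_vector_derivative]
          inner_has_real_derivative[OF Z_it_deriv_has_vector_derivative])+ (simp add: algebra_simps)
  qed
  have form: "W \<bullet> (?H *v V) = D2 V W" for V W
  proof -
    have s: "\<phi>\<^sup>2 = ?s X" by (simp add: \<phi>_def power2_norm_eq_inner)
    have sets: "{1..4} = {1, 2, 3, 4::nat}" "{2..4} = {2, 3, 4::nat}" by auto
    have split: "W \<bullet> ((sum f I + sum g J + sum h K) *v V) =
        (\<Sum>i\<in>I. W \<bullet> (f i *v V)) + (\<Sum>i\<in>J. W \<bullet> (g i *v V)) + (\<Sum>i\<in>K. W \<bullet> (h i *v V))"
      for f g h :: "nat \<Rightarrow> mat6" and I J K
      by (simp add: matrix_vector_mult_add_rdistrib sum_mult_vec inner_sum_right inner_add_right)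
    have "(\<Sum>i=2..4. W \<bullet> ((H2_term k Q Z X i + transpose (H2_term k Q Z X i)) *v V)) =
        (\<Sum>i=1..4. c i (?s X) * (Q \<bullet> Z_it_deriv2 X Z i V W))"
      unfolding sets
      by (simp add: H2_form[where V = W and W = V] k s Z_it_deriv2_commute flip: \<phi>_def
          del: transpose_matrix_vector Z_it_deriv2.simps(2)) simp
    moreover have "(\<Sum>i=1..4. W \<bullet> ((H3_term k_bar Q Z X i + transpose (H3_term k_bar Q Z X i)) *v V)) =
        (\<Sum>i=1..4. c_bar i (?s X) * ((vec_fst X \<bullet> vec_fst W) * (Q \<bullet> Z_it_deriv X Z i V)
          + (vec_fst X \<bullet> vec_fst V) * (Q \<bullet> Z_it_deriv X Z i W)))"
      by (rule sum.cong[OF refl], subst H3_form) (auto simp: k s simp flip: \<phi>_def)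
    moreover have "(\<Sum>i=1..4. W \<bullet> (H1_term k_bar k_breve Q Z X i *v V)) =
        (\<Sum>i=1..4. (Q \<bullet> Z_it X Z i) * (c_bar i (?s X) * (vec_fst W \<bullet> vec_fst V)
          + c_breve i (?s X) * ((vec_fst X \<bullet> vec_fst W) * (vec_fst X \<bullet> vec_fst V))))"
      by (rule sum.cong[OF refl]) (simp add: H1_form k s flip: \<phi>_def)
    ultimately show ?thesis
      unfolding split D2_def by (simp add: sum.distrib[symmetric] algebra_simps)
  qed
  show ?thesis
    unfolding has_hessian_def
  proof (intro exI[of _ "\<lambda>Y. \<chi> j. D Y (axis j 1)"] conjI allI)
    have "\<forall>\<^sub>F Y in nhds X. ?s Y \<in> U"
      using eventually_nhds_in_open[OF open_norm_sq_preimage[OF U(1)], of X] U(2) by simp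
    then show "\<forall>\<^sub>F Y in nhds X. \<forall>j. has_partial (\<lambda>Y. Q \<bullet> (M Y *v Z)) ((\<chi> j. D Y (axis j 1)) $ j) j Y"
      by eventually_elim (simp add: has_partial_def d1)
    show "has_partial (\<lambda>Y. (\<chi> j. D Y (axis j 1)) $ j) (?H $ i $ j) i X" for i j
      unfolding matrix_entry[of ?H] form by (simp add: has_partial_def d2)
  qed
qed

section \<open>The two Hessians\<close>

lemma block_0 [simp]: "block 0 0 0 0 = 0"
  by (simp add: block_def vec_eq_iff split: sum.split)

lemma transpose_0 [simp]: "transpose 0 = 0"
  by (simp add: transpose_def vec_eq_iff)

text \<open>
  The odd part of the inverse series is the constant \<open>- 1 / 2\<close>, so its derivatives vanish and
  with them the terms missing from the sums over \<open>{2, 4}\<close>.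
\<close>

lemma inv_terms_extend:
  assumes b: "beta (norm (vec_fst X)) \<noteq> 0"
  shows "H1_inv Q Z X = (\<Sum>i=1..4. H1_term coeff_b_bar coeff_b_breve Q Z X i)"
    and "H2_inv Q Z X = (\<Sum>i=2..4. H2_term coeff_b Q Z X i + transpose (H2_term coeff_b Q Z X i))"
    and "H3_inv Q Z X = (\<Sum>i=1..4. H3_term coeff_b_bar Q Z X i + transpose (H3_term coeff_b_bar Q Z X i))"
proof -
  have sets: "{1..4} = {1, 2, 3, 4::nat}" "{2..4} = {2, 3, 4::nat}" by auto
  have z: "coeff_b 3 (norm (vec_fst X)) = 0" "coeff_b_bar 1 (norm (vec_fst X)) = 0"
    "coeff_b_bar 3 (norm (vec_fst X)) = 0" "coeff_b_breve 1 (norm (vec_fst X)) = 0"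
    "coeff_b_breve 3 (norm (vec_fst X)) = 0"
    by (simp_all add: coeff_b_eq[OF b] coeff_b_bar_eq[OF b] coeff_b_breve_eq[OF b]
        ad_coeff_def ad_coeff_bar_def ad_coeff_breve_def inv_odd_def)
  have "H1_term coeff_b_bar coeff_b_breve Q Z X i = 0" "H3_term coeff_b_bar Q Z X i = 0" if "i \<in> {1, 3}" for i
    using that z by (auto simp: H1_term_def H3_term_def Let_def)
  then show "H1_inv Q Z X = (\<Sum>i=1..4. H1_term coeff_b_bar coeff_b_breve Q Z X i)"
    "H3_inv Q Z X = (\<Sum>i=1..4. H3_term coeff_b_bar Q Z X i + transpose (H3_term coeff_b_bar Q Z X i))"
    unfolding H1_inv_def H3_inv_def sets by simp_all
  have "H2_term coeff_b Q Z X 3 = 0" using z by (simp add: H2_term_def Let_def)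
  then show "H2_inv Q Z X = (\<Sum>i=2..4. H2_term coeff_b Q Z X i + transpose (H2_term coeff_b Q Z X i))"
    unfolding H2_inv_def sets by simp
qed

theorem lemma6:
  fixes Q Z :: vec6
  shows "(\<forall>X. has_hessian (\<lambda>Y. Q \<bullet> (dexp Y *v Z)) (H1 Q Z X + H2 Q Z X + H3 Q Z X) X) \<and>
         (\<forall>X. beta (norm (vec_fst X)) \<noteq> 0 \<longrightarrow>
            has_hessian (\<lambda>Y. Q \<bullet> (dexp_inv Y *v Z))
              (H1_inv Q Z X + H2_inv Q Z X + H3_inv Q Z X) X)"
proof (intro conjI allI impI)
  fix X :: vec6
  show "has_hessian (\<lambda>Y. Q \<bullet> (dexp Y *v Z)) (H1 Q Z X + H2 Q Z X + H3 Q Z X) X"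
    unfolding H1_def H2_def H3_def
    by (rule has_hessian_ad_poly[where U = UNIV])
      (auto intro!: DERIV_ad_coeff DERIV_trig_tail_deriv
        simp: dexp_eq_ad_poly coeff_a_eq coeff_a_bar_eq coeff_a_breve_eq simp del: trig_tail_deriv.simps)
next
  fix X :: vec6
  assume b: "beta (norm (vec_fst X)) \<noteq> 0"
  show "has_hessian (\<lambda>Y. Q \<bullet> (dexp_inv Y *v Z)) (H1_inv Q Z X + H2_inv Q Z X + H3_inv Q Z X) X"
    unfolding inv_terms_extend[OF b]
  proof (rule has_hessian_ad_poly[where U = "{s. trig_tail 2 s \<noteq> 0}"])
    show "vec_fst X \<bullet> vec_fst X \<in> {s. trig_tail 2 s \<noteq> 0}"
      using b by (simp add: beta_eq power2_norm_eq_inner)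
  qed (use b in \<open>auto intro!: open_trig_tail_2 DERIV_ad_coeff DERIV_inv_odd DERIV_cot_deriv
      simp: dexp_inv_eq_ad_poly coeff_b_eq coeff_b_bar_eq coeff_b_breve_eq\<close>)
qed

end
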